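(* Let $a,b>0$, let $(X,d)$ be a locally compact Polish metric space, let $k\ge2$ be an integer, let $\mu_1,\dots,\mu_k\in\mathcal{M}(X)$ have compact supports, let $\lambda_1,\dots,\lambda_k$ be positive reals with $\sum_{i=1}^k\lambda_i=1$, and let $K=\bigcup_{i=1}^k\mathrm{supp}(\mu_i)$. Then $\inf(B)=\sup(B^* )$, i.e. $$\inf\left\{\sum_{i=1}^k\lambda_i\,\widetilde{W}^{a,b}_2(\mu_i,\mu)^2 : \mu\in\mathcal{M}(X),\ \mathrm{supp}(\mu)\subset K\right\}=\sup\left\{\sum_{i=1}^k\int_K\overline{S}_{\lambda_i}f_i(x)\,d\mu_i(x) : f_i\in F_{\lambda_i}\ (1\le i\le k),\ \sum_{i=1}^kf_i=0\right\}.$$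
   Context: $\mathcal{M}(X)$ is the set of nonnegative finite Borel measures on $X$; $\mathcal{M}_2(X)$ is the subset of those with finite second moment. For a finite signed Borel measure $\mu=\mu^+-\mu^-$, $|\mu|:=\mu^+(X)+\mu^-(X)$. For $\mu_1,\mu_2\in\mathcal{M}_2(X)$ with $|\mu_1|=|\mu_2|$, $W_2(\mu_1,\mu_2):=\left(|\mu_1|\inf_{\boldsymbol\pi\in\Pi(\mu_1,\mu_2)}\int_{X\times X}d^2(x,y)\,d\boldsymbol\pi(x,y)\right)^{1/2}$, where $\Pi(\mu_1,\mu_2)$ is the set of Borel probability measures $\boldsymbol\pi$ on $X\times X$ with $|\mu_1|\boldsymbol\pi(A\times X)=\mu_1(A)$ and $|\mu_2|\boldsymbol\pi(X\times B)=\mu_2(B)$ for all Borel $A,B$. The generalized Wasserstein distance is $$\widetilde{W}^{a,b}_2(\mu_1,\mu_2):=\left(\inf\left\{a|\mu_1-\widetilde\mu_1|+a|\mu_2-\widetilde\mu_2|+b^2W_2^2(\widetilde\mu_1,\widetilde\mu_2):\ \widetilde\mu_1,\widetilde\mu_2\in\mathcal{M}_2(X),\ |\widetilde\mu_1|=|\widetilde\mu_2|\right\}\right)^{1/2}.$$ For $\lambda>0$, $F_\lambda:=\{f\in C_b(K): f(x)\le\lambda a\ \text{for every }x\in K\}$, where $C_b(K)$ is the space of bounded continuous real functions on $K$. For $f\in F_\lambda$ and $x\in K$, $S_\lambda f(x):=\inf_{y\in K}\{\lambda b^2d^2(x,y)-f(y)\}$ and $\overline S_\lambda f(x):=\min\{S_\lambda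 f(x),\lambda a\}$. *)

theory Defs
  imports "HOL-Probability.Probability"
begin

definition finite_borel_measures :: "'a::topological_space measure set" where
  "finite_borel_measures = {M. sets M = sets borel \<and> finite_measure M}"

definition finite_borel_measures2 :: "'a::metric_space measure set" where
  "finite_borel_measures2 = {M \<in> finite_borel_measures.
     \<exists>x0. (\<integral>\<^sup>+ x. ennreal ((dist x x0)\<^sup>2) \<partial>M) < \<infinity>}"

definition supp_measure :: "'a::topological_space measure \<Rightarrow> 'a set" where
  "supp_measure M = {x. \<forall>U. open U \<longrightarrow> x \<in> U \<longrightarrow> emeasure M U > 0}"

text \<open>Finite signed Borel measures are real-valued set functions, of which only the values on Borel
  sets are used. \<open>jordan_decomposition \<nu> P N\<close> says that \<open>P\<close> and \<open>N\<close> are the positive and the negative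
  part of \<open>\<nu>\<close>.\<close>

definition jordan_decomposition ::
    "('a::topological_space set \<Rightarrow> real) \<Rightarrow> 'a measure \<Rightarrow> 'a measure \<Rightarrow> bool" where
  "jordan_decomposition \<nu> P N \<longleftrightarrow>
     P \<in> finite_borel_measures \<and> N \<in> finite_borel_measures \<and>
     (\<forall>A \<in> sets borel. \<nu> A = measure P A - measure N A) \<and>
     (\<exists>D \<in> sets borel. emeasure P (- D) = 0 \<and> emeasure N D = 0)"

definition signed_norm :: "('a::topological_space set \<Rightarrow> real) \<Rightarrow> real" where
  "signed_norm \<nu> = (THE r. \<exists>P N. jordan_decomposition \<nu> P N \<and> r = measure P UNIV + measure N UNIV)"

lemma jordan_decomposition_measures:
  assumes J: "jordan_decomposition \<nu> P N" and D: "D \<in> sets borel"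
    and PD: "emeasure P (- D) = 0" and ND: "emeasure N D = 0" and A: "A \<in> sets borel"
  shows "\<nu> (A \<inter> D) = measure P A" and "\<nu> (A - D) = - measure N A"
proof -
  have fb: "P \<in> finite_borel_measures" "N \<in> finite_borel_measures"
    using J by (auto simp: jordan_decomposition_def)
  then have sP: "sets P = sets borel" and sN: "sets N = sets borel"
    and fP: "finite_measure P" and fN: "finite_measure N"
    by (auto simp: finite_borel_measures_def)
  have nu: "\<nu> B = measure P B - measure N B" if "B \<in> sets borel" for B
    using J that by (auto simp: jordan_decomposition_def)
  have P0: "measure P (A - D) = 0"
    using emeasure_eq_0[of "- D" P "A - D"] PD D sP by (simp add: measure_def Diff_eq)
  have N0: "measure N (A \<inter> D) = 0"
    using emeasure_eq_0[of D N "A \<inter> D"] ND D sN by (auto simp: measure_def)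
  have P1: "measure P A = measure P (A \<inter> D) + measure P (A - D)"
    using finite_measure.finite_measure_Union[OF fP, of "A \<inter> D" "A - D"] A D sP
    by (simp add: Int_Diff_disjoint Int_Diff_Un)
  have N1: "measure N A = measure N (A \<inter> D) + measure N (A - D)"
    using finite_measure.finite_measure_Union[OF fN, of "A \<inter> D" "A - D"] A D sN
    by (simp add: Int_Diff_disjoint Int_Diff_Un)
  show "\<nu> (A \<inter> D) = measure P A" using nu[of "A \<inter> D"] A D P0 N0 P1 by simp
  show "\<nu> (A - D) = - measure N A" using nu[of "A - D"] A D P0 N0 N1 by simp
qed

lemma jordan_decomposition_unique_mass:
  assumes J: "jordan_decomposition \<nu> P N" and J': "jordan_decomposition \<nu> P' N'"
  shows "measure P UNIV + measure N UNIV = measure P' UNIV + measure N' UNIV"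
proof -
  have le: "measure P UNIV + measure N UNIV \<le> measure P' UNIV + measure N' UNIV"
    if J: "jordan_decomposition \<nu> P N" and J': "jordan_decomposition \<nu> P' N'"
    for P N P' N'
  proof -
    obtain D where D: "D \<in> sets borel" "emeasure P (- D) = 0" "emeasure N D = 0"
      using J by (auto simp: jordan_decomposition_def)
    have b: "P' \<in> finite_borel_measures" "N' \<in> finite_borel_measures"
      using J' by (auto simp: jordan_decomposition_def)
    then have "sets P' = sets borel" "sets N' = sets borel"
      and f: "finite_measure P'" "finite_measure N'"
      by (auto simp: finite_borel_measures_def)
    then have sp: "space P' = UNIV" "space N' = UNIV"
      by (auto dest: sets_eq_imp_space_eq)
    have "measure P UNIV = \<nu> D" "measure N UNIV = - \<nu> (- D)"
      using jordan_decomposition_measures[OF J D, of UNIV] by (simp_all add: Compl_eq_Diff_UNIV)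
    moreover have "\<nu> D = measure P' D - measure N' D" "\<nu> (- D) = measure P' (- D) - measure N' (- D)"
      using J' D(1) by (auto simp: jordan_decomposition_def)
    moreover have "measure P' D \<le> measure P' UNIV" "measure N' (- D) \<le> measure N' UNIV"
      using finite_measure.bounded_measure f sp by metis+
    ultimately show ?thesis
      using measure_nonneg[of P' "- D"] measure_nonneg[of N' D] by linarith
  qed
  show ?thesis using le[OF J J'] le[OF J' J] by simp
qed

lemma signed_norm_eq:
  assumes "jordan_decomposition \<nu> P N"
  shows "signed_norm \<nu> = measure P UNIV + measure N UNIV"
  unfolding signed_norm_def
  using assms jordan_decomposition_unique_mass by (intro the_equality) blast+

lemma jordan_decomposition_diff_exists:
  assumes "M \<in> finite_borel_measures" and "N \<in> finite_borel_measures"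
  shows "\<exists>P Q. jordan_decomposition (\<lambda>A. measure M A - measure N A) P Q"
proof -
  have sM: "sets M = sets borel" and sN: "sets N = sets borel"
    and fM: "finite_measure M" and fN: "finite_measure N"
    using assms by (auto simp: finite_borel_measures_def)
  have NM[simp]: "sets N = sets M" using sM sN by simp
  obtain Y where Y: "Y \<in> sets M"
    and Y1: "\<And>X. X \<in> sets M \<Longrightarrow> X \<subseteq> Y \<Longrightarrow> emeasure N X \<le> emeasure M X"
    and Y2: "\<And>X. X \<in> sets M \<Longrightarrow> X \<inter> Y = {} \<Longrightarrow> emeasure M X \<le> emeasure N X"
    using finite_unsigned_Hahn_decomposition[OF fM fN] by auto
  define res where "res L B = density L (indicator B)" for L :: "'a measure" and B
  have res: "emeasure (res L B) A = emeasure L (A \<inter> B)"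
    if "A \<in> sets M" "B \<in> sets M" "sets L = sets M" for L A B
    using that by (simp add: res_def emeasure_density nn_integral_indicator
        flip: indicator_inter_arith) (simp add: Int_commute)
  have sres[simp]: "sets (res L B) = sets L" for L B by (simp add: res_def)
  have fres: "finite_measure (res L B)" if "finite_measure L" "sets L = sets M" "B \<in> sets M" for L B
  proof (rule finite_measureI)
    have "space (res L B) \<in> sets M" using that(2) by (metis sets.top sres)
    then have "emeasure (res L B) (space (res L B)) = emeasure L (space (res L B) \<inter> B)"
      using res that by blast
    then show "emeasure (res L B) (space (res L B)) \<noteq> \<infinity>"
      using finite_measure.emeasure_finite[OF that(1)] by (simp add: top.not_eq_extremum)
  qed
  define Z where "Z = - Y"
  have Z: "Z \<in> sets M" using Y sM by (simp add: Z_def)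
  define P where "P = diff_measure (res M Y) (res N Y)"
  define Q where "Q = diff_measure (res N Z) (res M Z)"
  have eP: "emeasure P A = emeasure M (A \<inter> Y) - emeasure N (A \<inter> Y)" if "A \<in> sets M" for A
    unfolding P_def
    by (subst emeasure_diff_measure) (use that Y Y1 fM fN in \<open>auto simp: res intro!: fres\<close>)
  have eQ: "emeasure Q A = emeasure N (A \<inter> Z) - emeasure M (A \<inter> Z)" if "A \<in> sets M" for A
    unfolding Q_def
    by (subst emeasure_diff_measure) (use that Z Y2 fM fN in \<open>auto simp: res Z_def intro!: fres\<close>)
  have sPQ: "sets P = sets borel" "sets Q = sets borel"
    by (simp_all add: P_def Q_def sM)
  have finM: "emeasure M A \<noteq> \<infinity>" and finN: "emeasure N A \<noteq> \<infinity>" for A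
    using finite_measure.emeasure_finite[OF fM] finite_measure.emeasure_finite[OF fN] by auto
  have "finite_measure P" "finite_measure Q"
  proof -
    have "space P \<in> sets M" "space Q \<in> sets M" using sPQ sM by (metis sets.top)+
    then show "finite_measure P" "finite_measure Q"
      using finM finN
      by (auto intro!: finite_measureI simp: eP eQ ennreal_minus_eq_top)
  qed
  then have PQ: "P \<in> finite_borel_measures" "Q \<in> finite_borel_measures"
    using sPQ by (auto simp: finite_borel_measures_def)
  have mP: "measure P A = measure M (A \<inter> Y) - measure N (A \<inter> Y)" if "A \<in> sets M" for A
  proof -
    have "emeasure N (A \<inter> Y) \<le> emeasure M (A \<inter> Y)" using Y Y1 that by auto
    then show ?thesis
      using finite_measure.emeasure_eq_measure[OF fM] finite_measure.emeasure_eq_measure[OF fN]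
      by (simp add: measure_def[of P] eP[OF that] ennreal_minus)
  qed
  have mQ: "measure Q A = measure N (A \<inter> Z) - measure M (A \<inter> Z)" if "A \<in> sets M" for A
  proof -
    have "emeasure M (A \<inter> Z) \<le> emeasure N (A \<inter> Z)" using Z Y2 that by (auto simp: Z_def)
    then show ?thesis
      using finite_measure.emeasure_eq_measure[OF fM] finite_measure.emeasure_eq_measure[OF fN]
      by (simp add: measure_def[of Q] eQ[OF that] ennreal_minus)
  qed
  have "measure M A - measure N A = measure P A - measure Q A" if "A \<in> sets borel" for A
  proof -
    have A: "A \<in> sets M" using that sM by simp
    have "A \<inter> Y \<inter> (A \<inter> Z) = {}" "A \<inter> Y \<union> A \<inter> Z = A" by (auto simp: Z_def)
    then have "measure L A = measure L (A \<inter> Y) + measure L (A \<inter> Z)"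
      if "finite_measure L" "sets L = sets M" for L
      using finite_measure.finite_measure_Union[OF that(1), of "A \<inter> Y" "A \<inter> Z"] that A Y Z by auto
    from this[OF fM] this[OF fN] show ?thesis using mP[OF A] mQ[OF A] by simp
  qed
  moreover have "emeasure P (- Y) = 0" "emeasure Q Y = 0"
    using eP[of "- Y"] eQ[of Y] Y Z by (simp_all add: Z_def)
  ultimately have "jordan_decomposition (\<lambda>A. measure M A - measure N A) P Q"
    using PQ Y sM by (auto simp: jordan_decomposition_def)
  then show ?thesis by blast
qed

definition transport_plans ::
    "'a::topological_space measure \<Rightarrow> 'a measure \<Rightarrow> ('a \<times> 'a) measure set" where
  "transport_plans \<mu>1 \<mu>2 = {\<pi>. sets \<pi> = sets borel \<and> prob_space \<pi> \<and>
     (\<forall>A \<in> sets borel. measure \<mu>1 UNIV * measure \<pi> (A \<times> UNIV) = measure \<mu>1 A) \<and>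
     (\<forall>B \<in> sets borel. measure \<mu>2 UNIV * measure \<pi> (UNIV \<times> B) = measure \<mu>2 B)}"

text \<open>The cost is a nonnegative extended integral, so that plans of infinite cost do not count as
  plans of cost 0. On measures of equal mass with finite second moments the infimum is finite
  (lemma \<open>transport_cost_finite\<close> below), so that \<open>enn2real\<close> loses nothing.\<close>

definition W2 :: "'a::metric_space measure \<Rightarrow> 'a measure \<Rightarrow> real" where
  "W2 \<mu>1 \<mu>2 = sqrt (measure \<mu>1 UNIV *
     enn2real (INF \<pi> \<in> transport_plans \<mu>1 \<mu>2. \<integral>\<^sup>+ (x, y). ennreal ((dist x y)\<^sup>2) \<partial>\<pi>))"

definition gen_wasserstein ::
    "real \<Rightarrow> real \<Rightarrow> 'a::metric_space measure \<Rightarrow> 'a measure \<Rightarrow> real" where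
  "gen_wasserstein a b \<mu>1 \<mu>2 = sqrt (Inf
     {a * signed_norm (\<lambda>A. measure \<mu>1 A - measure \<nu>1 A) +
      a * signed_norm (\<lambda>A. measure \<mu>2 A - measure \<nu>2 A) + b\<^sup>2 * (W2 \<nu>1 \<nu>2)\<^sup>2 | \<nu>1 \<nu>2.
      \<nu>1 \<in> finite_borel_measures2 \<and> \<nu>2 \<in> finite_borel_measures2 \<and>
      measure \<nu>1 UNIV = measure \<nu>2 UNIV})"

text \<open>A function on \<open>K\<close> is represented by a function on the whole type; only its values on \<open>K\<close>
  are used.\<close>

definition F_set :: "real \<Rightarrow> 'a::topological_space set \<Rightarrow> real \<Rightarrow> ('a \<Rightarrow> real) set" where
  "F_set a K l = {f. continuous_on K f \<and> bounded (f ` K) \<and> (\<forall>x\<in>K. f x \<le> l * a)}"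

definition S_op :: "real \<Rightarrow> 'a::metric_space set \<Rightarrow> real \<Rightarrow> ('a \<Rightarrow> real) \<Rightarrow> 'a \<Rightarrow> real" where
  "S_op b K l f x = (INF y \<in> K. l * b\<^sup>2 * (dist x y)\<^sup>2 - f y)"

definition Sbar_op ::
    "real \<Rightarrow> real \<Rightarrow> 'a::metric_space set \<Rightarrow> real \<Rightarrow> ('a \<Rightarrow> real) \<Rightarrow> 'a \<Rightarrow> real" where
  "Sbar_op a b K l f x = min (S_op b K l f x) (l * a)"

lemma second_moment_any_point:
  assumes "M \<in> finite_borel_measures2"
  shows "(\<integral>\<^sup>+ x. ennreal ((dist x z)\<^sup>2) \<partial>M) < \<infinity>"
proof -
  have "M \<in> finite_borel_measures" using assms by (auto simp: finite_borel_measures2_def)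
  then have sM[measurable_cong]: "sets M = sets borel" and fM: "finite_measure M"
    by (auto simp: finite_borel_measures_def)
  interpret finite_measure M by (rule fM)
  obtain x0 where x0: "(\<integral>\<^sup>+ x. ennreal ((dist x x0)\<^sup>2) \<partial>M) < \<infinity>"
    using assms by (auto simp: finite_borel_measures2_def)
  have [measurable]: "(\<lambda>x. dist x x0) \<in> borel_measurable M"
    unfolding measurable_cong_sets[OF sM refl]
    by (intro borel_measurable_continuous_onI continuous_intros)
  have "(\<integral>\<^sup>+ x. ennreal ((dist x z)\<^sup>2) \<partial>M)
      \<le> (\<integral>\<^sup>+ x. 2 * ennreal ((dist x x0)\<^sup>2) + ennreal (2 * (dist z x0)\<^sup>2) \<partial>M)"
  proof (rule nn_integral_mono)
    fix x
    have "(dist x z)\<^sup>2 \<le> (dist x x0 + dist z x0)\<^sup>2"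
      by (intro power_mono dist_triangle2) simp
    also have "\<dots> \<le> 2 * (dist x x0)\<^sup>2 + 2 * (dist z x0)\<^sup>2"
      using sum_squares_bound[of "dist x x0" "dist z x0"] by (simp add: power2_sum)
    finally have "ennreal ((dist x z)\<^sup>2) \<le> ennreal (2 * (dist x x0)\<^sup>2 + 2 * (dist z x0)\<^sup>2)"
      by (rule ennreal_leI)
    then show "ennreal ((dist x z)\<^sup>2) \<le> 2 * ennreal ((dist x x0)\<^sup>2) + ennreal (2 * (dist z x0)\<^sup>2)"
      by (simp add: ennreal_plus ennreal_mult')
  qed
  also have "\<dots> = 2 * (\<integral>\<^sup>+ x. ennreal ((dist x x0)\<^sup>2) \<partial>M)
      + ennreal (2 * (dist z x0)\<^sup>2) * emeasure M (space M)"
    by (simp add: nn_integral_add nn_integral_cmult)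
  also have "\<dots> < \<infinity>"
    using x0 by (simp add: ennreal_mult_less_top emeasure_eq_measure)
  finally show ?thesis .
qed

lemma transport_cost_finite:
  fixes \<mu>1 \<mu>2 :: "'a::polish_space measure"
  assumes "\<mu>1 \<in> finite_borel_measures2" and "\<mu>2 \<in> finite_borel_measures2"
    and eq: "measure \<mu>1 UNIV = measure \<mu>2 UNIV"
  shows "(INF \<pi> \<in> transport_plans \<mu>1 \<mu>2. \<integral>\<^sup>+ (x, y). ennreal ((dist x y)\<^sup>2) \<partial>\<pi>) < \<infinity>"
proof -
  define z :: 'a where "z = undefined"
  define m where "m = measure \<mu>1 UNIV"
  have fb: "\<mu>1 \<in> finite_borel_measures" "\<mu>2 \<in> finite_borel_measures"
    using assms by (auto simp: finite_borel_measures2_def)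
  have ex: "\<exists>p. prob_space p \<and> sets p = sets borel \<and> (\<forall>A \<in> sets borel. m * measure p A = measure M A)
      \<and> (\<integral>\<^sup>+ x. ennreal ((dist x z)\<^sup>2) \<partial>p) < \<infinity>"
    if M: "M \<in> finite_borel_measures2" and mM: "measure M UNIV = m" for M :: "'a measure"
  proof -
    have "M \<in> finite_borel_measures" using M by (auto simp: finite_borel_measures2_def)
    then have sM[measurable_cong]: "sets M = sets borel" and fM: "finite_measure M"
      by (auto simp: finite_borel_measures_def)
    have spM: "space M = UNIV" using sM by (auto dest: sets_eq_imp_space_eq)
    interpret finite_measure M by (rule fM)
    show ?thesis
    proof (cases "m = 0")
      case True
      have "measure M A = 0" for A
        using bounded_measure[of A] mM True spM by (metis measure_nonneg order_antisym)
      then show ?thesis using True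
        by (intro exI[of _ "return borel z"])
          (auto intro!: prob_space_return simp: nn_integral_return)
    next
      case False
      then have m: "m > 0" using mM by (metis measure_nonneg order_le_less)
      let ?p = "scale_measure (ennreal (1 / m)) M"
      have "emeasure M UNIV = ennreal m"
        using mM emeasure_eq_measure by simp
      then have "prob_space ?p"
        using m by (intro prob_spaceI) (simp add: spM space_scale_measure flip: ennreal_mult)
      moreover have "m * measure ?p A = measure M A" for A
        using m by (simp add: measure_scale_measure)
      moreover have "(\<integral>\<^sup>+ x. ennreal ((dist x z)\<^sup>2) \<partial>?p) < \<infinity>"
      proof -
        have "(\<lambda>x. ennreal ((dist x z)\<^sup>2)) \<in> borel_measurable M"
          unfolding measurable_cong_sets[OF sM refl]
          by (intro measurable_compose[OF _ measurable_ennreal] borel_measurable_continuous_onI continuous_intros)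
        then show ?thesis
          using second_moment_any_point[OF M, of z]
          by (simp add: nn_integral_scale_measure ennreal_mult_less_top)
      qed
      ultimately show ?thesis using sM by (intro exI[of _ ?p]) auto
    qed
  qed
  obtain p where p: "prob_space p" "sets p = sets borel"
      "\<And>A. A \<in> sets borel \<Longrightarrow> m * measure p A = measure \<mu>1 A"
      "(\<integral>\<^sup>+ x. ennreal ((dist x z)\<^sup>2) \<partial>p) < \<infinity>"
    using ex[OF assms(1)] by (auto simp: m_def)
  obtain q where q: "prob_space q" "sets q = sets borel"
      "\<And>A. A \<in> sets borel \<Longrightarrow> m * measure q A = measure \<mu>2 A"
      "(\<integral>\<^sup>+ x. ennreal ((dist x z)\<^sup>2) \<partial>q) < \<infinity>"
    using ex[OF assms(2)] eq by (auto simp: m_def)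
  note [measurable_cong] = p(2) q(2)
  have sp: "space p = UNIV" "space q = UNIV" using p(2) q(2) by (auto dest: sets_eq_imp_space_eq)
  interpret p: prob_space p by (rule p)
  interpret q: prob_space q by (rule q)
  interpret pq: pair_prob_space p q ..
  let ?\<pi> = "p \<Otimes>\<^sub>M q"
  have spi: "sets ?\<pi> = sets borel"
    using sets_pair_measure_cong[OF p(2) q(2)] unfolding borel_prod .
  have "measure ?\<pi> (A \<times> UNIV) = measure p A" "measure ?\<pi> (UNIV \<times> A) = measure q A"
    if "A \<in> sets borel" for A
    using that p(2) q(2) sp p.prob_space q.prob_space
    by (simp_all add: measure_def q.emeasure_pair_measure_Times
        p.emeasure_space_1[unfolded sp] q.emeasure_space_1[unfolded sp])
  then have plan: "?\<pi> \<in> transport_plans \<mu>1 \<mu>2"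
    using spi p(3) q(3) eq pq.prob_space_axioms by (auto simp: transport_plans_def m_def)
  have md: "(\<lambda>x::'a. ennreal ((dist x z)\<^sup>2)) \<in> borel_measurable borel"
    by (intro measurable_compose[OF _ measurable_ennreal] borel_measurable_continuous_onI continuous_intros)
  have md1[measurable]: "(\<lambda>x. ennreal ((dist x z)\<^sup>2)) \<in> borel_measurable p"
    using md p(2) by (simp cong: measurable_cong_sets)
  have md2[measurable]: "(\<lambda>x. ennreal ((dist x z)\<^sup>2)) \<in> borel_measurable q"
    using md q(2) by (simp cong: measurable_cong_sets)
  have "(\<integral>\<^sup>+ (x, y). ennreal ((dist x y)\<^sup>2) \<partial>?\<pi>)
      \<le> (\<integral>\<^sup>+ w. 2 * ennreal ((dist (fst w) z)\<^sup>2) + 2 * ennreal ((dist (snd w) z)\<^sup>2) \<partial>?\<pi>)"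
  proof (rule nn_integral_mono)
    fix w :: "'a \<times> 'a"
    obtain x y where w: "w = (x, y)" by (cases w)
    have "(dist x y)\<^sup>2 \<le> (dist x z + dist y z)\<^sup>2"
      by (intro power_mono dist_triangle2) simp
    also have "\<dots> \<le> 2 * (dist x z)\<^sup>2 + 2 * (dist y z)\<^sup>2"
      using sum_squares_bound[of "dist x z" "dist y z"] by (simp add: power2_sum)
    finally have "ennreal ((dist x y)\<^sup>2) \<le> ennreal (2 * (dist x z)\<^sup>2 + 2 * (dist y z)\<^sup>2)"
      by (rule ennreal_leI)
    then show "(case w of (x, y) \<Rightarrow> ennreal ((dist x y)\<^sup>2))
        \<le> 2 * ennreal ((dist (fst w) z)\<^sup>2) + 2 * ennreal ((dist (snd w) z)\<^sup>2)"
      by (simp add: w ennreal_plus ennreal_mult')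
  qed
  also have "\<dots> = 2 * (\<integral>\<^sup>+ w. ennreal ((dist (fst w) z)\<^sup>2) \<partial>?\<pi>)
      + 2 * (\<integral>\<^sup>+ w. ennreal ((dist (snd w) z)\<^sup>2) \<partial>?\<pi>)"
    using measurable_compose[OF measurable_fst md1] measurable_compose[OF measurable_snd md2]
    by (simp add: nn_integral_add nn_integral_cmult)
  also have "(\<integral>\<^sup>+ w. ennreal ((dist (fst w) z)\<^sup>2) \<partial>?\<pi>) = (\<integral>\<^sup>+ x. ennreal ((dist x z)\<^sup>2) \<partial>p)"
    using measurable_compose[OF measurable_fst md1]
    by (subst q.nn_integral_fst[symmetric]) (auto simp: q.emeasure_space_1)
  also have "(\<integral>\<^sup>+ w. ennreal ((dist (snd w) z)\<^sup>2) \<partial>?\<pi>) = (\<integral>\<^sup>+ x. ennreal ((dist x z)\<^sup>2) \<partial>q)"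
    using measurable_compose[OF measurable_snd md2]
    by (subst q.nn_integral_fst[symmetric]) (auto simp: p.emeasure_space_1)
  also have "2 * (\<integral>\<^sup>+ x. ennreal ((dist x z)\<^sup>2) \<partial>p) + 2 * (\<integral>\<^sup>+ x. ennreal ((dist x z)\<^sup>2) \<partial>q) < \<infinity>"
    using p(4) q(4) by (simp add: ennreal_mult_less_top)
  finally show ?thesis using plan by (auto simp: INF_less_iff)
qed

end

theory Submission
  imports Defs
begin

text \<open>Weak duality: the potentials \<open>Sbar f\<close> and \<open>f\<close> can be replaced by potentials with values in
  \<open>[- l a, l a]\<close> on the whole space, which pair with the total variation terms and with every
  transport plan. Strong duality needs neither the Riesz representation theorem nor compactness of
  measures: since only the optimal values are compared, it suffices to quantize \<open>K\<close> by a finite net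
  \<open>Y\<close>. By Farkas' lemma, for every level \<open>V\<close> either the dual problem on \<open>Y\<close> attains the value \<open>V\<close>, or
  the primal problem on \<open>Y\<close> has a solution of cost below \<open>V\<close>. Discrete potentials extend to \<open>K\<close> by a
  partition of unity, which preserves the linear constraints, and a discrete plan is spread over the
  cells of the net; both operations change the value by an arbitrarily small amount.\<close>

text \<open>The finite primal is a linear program in partial plans \<open>\<gamma> i\<close> and a
  common target \<open>n\<close>, where mass left unmatched on either side costs
  \<open>lam i * a\<close> per unit. In its dual the two kinds of unmatched mass produce the caps
  \<open>lam i * a\<close> on both potentials, which mirror the cap in \<open>F_set\<close> and the
  \<open>min\<close> in \<open>Sbar_op\<close>; the choice of \<open>n\<close> produces the
  constraint on the sum of the \<open>f i\<close>. The level is set \<open>e / 2\<close> below the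
  primal infimum. A discrete primal solution below that level would turn into an admissible measure
  whose value is below the infimum, so the dual alternative must occur, and no optimizer is ever
  needed. The mass of \<open>n\<close> has no a priori bound, so no error may be proportional to it.
  Errors are charged to mass of the \<open>\<mu> i\<close> instead: the transported part of the plan
  number \<open>i\<close> is at most the mass of \<open>\<mu> i\<close>. Hence the tolerance
  \<open>\<eta> = e / (2 * (T + 1))\<close> for squared distances, where \<open>T\<close> collects
  the weighted masses of the \<open>\<mu> i\<close>.\<close>

section \<open>Farkas' lemma by Fourier-Motzkin elimination\<close>

lemma real_between_finite_sets:
  fixes L U :: "real set"
  assumes "finite L" "finite U" and "\<And>l u. l \<in> L \<Longrightarrow> u \<in> U \<Longrightarrow> l \<le> u"
  obtains t where "\<And>l. l \<in> L \<Longrightarrow> l \<le> t" "\<And>u. u \<in> U \<Longrightarrow> t \<le> u"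
proof (cases "L = {}")
  case True
  show ?thesis
  proof (cases "U = {}")
    case True
    then show ?thesis using \<open>L = {}\<close> that by auto
  next
    case False
    then show ?thesis using \<open>L = {}\<close> that[of "Min U"] assms by auto
  qed
next
  case False
  then show ?thesis using that[of "Max L"] assms by auto
qed

text \<open>Fourier-Motzkin elimination removes one unknown of \<open>J\<close> per induction step.
  Multipliers are not recorded: the certificate is membership in \<open>Q\<close>, any set of
  inequalities closed under sums and positive scaling, and a later choice of \<open>Q\<close>
  carries the multipliers as existential witnesses. Both multipliers of an elimination step are
  strictly positive, hence the form of \<open>scale\<close>.\<close>

lemma farkas_infeasible:
  fixes Q :: "(('j \<Rightarrow> real) \<times> real) set"
  assumes add: "\<And>c \<beta> c' \<beta>'. (c, \<beta>) \<in> Q \<Longrightarrow> (c', \<beta>') \<in> Q \<Longrightarrow> (\<lambda>j. c j + c' j, \<beta> + \<beta>') \<in> Q"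
    and scale: "\<And>c \<beta> r. (c, \<beta>) \<in> Q \<Longrightarrow> 0 < r \<Longrightarrow> (\<lambda>j. r * c j, r * \<beta>) \<in> Q"
    and "finite J" "finite C" "C \<subseteq> Q"
    and "\<And>c \<beta> j. (c, \<beta>) \<in> C \<Longrightarrow> j \<notin> J \<Longrightarrow> c j = 0"
    and "\<nexists>x. \<forall>(c, \<beta>) \<in> C. (\<Sum>j\<in>J. c j * x j) \<le> \<beta>"
  shows "\<exists>\<beta><0. (\<lambda>_. 0, \<beta>) \<in> Q"
  using assms(3-)
proof (induction J arbitrary: C rule: finite_induct)
  case empty
  then obtain c \<beta> where c: "(c, \<beta>) \<in> C" "\<beta> < 0" by force
  then have "c = (\<lambda>_. 0)" using empty.prems(3) by auto
  then show ?case using c empty.prems(2) by auto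
next
  case (insert j J)
  define Z P N where "Z = {p \<in> C. fst p j = 0}" and "P = {p \<in> C. fst p j > 0}"
    and "N = {p \<in> C. fst p j < 0}"
  \<comment> \<open>Multiplying \<open>p\<close> by \<open>- fst n j > 0\<close> and
    \<open>n\<close> by \<open>fst p j > 0\<close> cancels the coefficient of
    \<open>j\<close>.\<close>
  define comb where "comb p n = ((\<lambda>i. - fst n j * fst p i + fst p j * fst n i),
      - fst n j * snd p + fst p j * snd n)" for p n :: "('j \<Rightarrow> real) \<times> real"
  define C' where "C' = Z \<union> (\<lambda>(p, n). comb p n) ` (P \<times> N)"
  have "finite C'" using insert.prems(1) by (auto simp: C'_def Z_def P_def N_def)
  moreover have "comb p n \<in> Q" if "p \<in> P" "n \<in> N" for p n
  proof -
    have "(fst p, snd p) \<in> Q" "(fst n, snd n) \<in> Q"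
      using that insert.prems(2) by (auto simp: P_def N_def)
    then have "((\<lambda>i. - fst n j * fst p i), - fst n j * snd p) \<in> Q"
      "((\<lambda>i. fst p j * fst n i), fst p j * snd n) \<in> Q"
      using that scale[of "fst p" "snd p" "- fst n j"] scale[of "fst n" "snd n" "fst p j"]
      by (simp_all add: P_def N_def)
    then show ?thesis unfolding comb_def by (rule add)
  qed
  then have "C' \<subseteq> Q" using insert.prems(2) by (auto simp: C'_def Z_def)
  moreover have "c i = 0" if "(c, \<beta>) \<in> C'" "i \<notin> J" for c \<beta> i
    using that(1) unfolding C'_def
  proof
    assume "(c, \<beta>) \<in> Z"
    then show ?thesis using insert.prems(3)[of c \<beta> i] that(2) by (cases "i = j") (auto simp: Z_def)
  next
    assume "(c, \<beta>) \<in> (\<lambda>(p, n). comb p n) ` (P \<times> N)"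
    then obtain p n where pn: "p \<in> P" "n \<in> N" and "(c, \<beta>) = comb p n" by auto
    then have c: "c = fst (comb p n)" by (metis fst_conv)
    show ?thesis
    proof (cases "i = j")
      case False
      then have "fst p i = 0" "fst n i = 0"
        using pn that(2) insert.prems(3)[of "fst p" "snd p" i] insert.prems(3)[of "fst n" "snd n" i]
        by (auto simp: P_def N_def)
      then show ?thesis using c by (simp add: comb_def)
    qed (use c in \<open>simp add: comb_def\<close>)
  qed
  moreover have "\<nexists>x. \<forall>(c, \<beta>) \<in> C'. (\<Sum>j\<in>J. c j * x j) \<le> \<beta>"
  proof
    assume "\<exists>x. \<forall>(c, \<beta>) \<in> C'. (\<Sum>j\<in>J. c j * x j) \<le> \<beta>"
    then obtain x where x: "\<And>c \<beta>. (c, \<beta>) \<in> C' \<Longrightarrow> (\<Sum>j\<in>J. c j * x j) \<le> \<beta>" by auto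
    define s where "s c = (\<Sum>j\<in>J. c j * x j)" for c
    \<comment> \<open>With the other unknowns fixed at \<open>x\<close>, the inequality
      \<open>p\<close> bounds the unknown \<open>j\<close> by \<open>bd p\<close>, from above for
      \<open>p\<close> in \<open>P\<close> and from below for \<open>p\<close> in \<open>N\<close>.
      The inequality \<open>comb p n\<close> at \<open>x\<close> says exactly that the lower bound
      does not exceed the upper one.\<close>
    define bd where "bd p = (snd p - s (fst p)) / fst p j" for p
    have le: "bd n \<le> bd p" if "p \<in> P" "n \<in> N" for p n
    proof -
      have sg: "fst p j > 0" "fst n j < 0" using that by (auto simp: P_def N_def)
      have "comb p n \<in> C'" using that by (auto simp: C'_def)
      then have "s (fst (comb p n)) \<le> snd (comb p n)" using x[of "fst (comb p n)"] by (auto simp: s_def)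
      moreover have "s (fst (comb p n)) = - fst n j * s (fst p) + fst p j * s (fst n)"
        unfolding s_def comb_def sum_distrib_left sum.distrib[symmetric]
        by (intro sum.cong) (auto simp: algebra_simps)
      ultimately have "- fst n j * (s (fst p) - snd p) + fst p j * (s (fst n) - snd n) \<le> 0"
        by (simp add: comb_def algebra_simps)
      then show ?thesis using sg by (simp add: bd_def divide_simps) (simp add: algebra_simps)
    qed
    have "finite (bd ` N)" "finite (bd ` P)" using insert.prems(1) by (auto simp: P_def N_def)
    then obtain t where t: "\<And>l. l \<in> bd ` N \<Longrightarrow> l \<le> t" "\<And>u. u \<in> bd ` P \<Longrightarrow> t \<le> u"
      by (rule real_between_finite_sets) (use le in auto)
    have "(\<Sum>i\<in>insert j J. c i * (x(j := t)) i) \<le> \<beta>" if "(c, \<beta>) \<in> C" for c \<beta>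
    proof -
      have "(\<Sum>i\<in>J. c i * (x(j := t)) i) = s c"
        unfolding s_def using insert.hyps by (intro sum.cong) auto
      then have eq: "(\<Sum>i\<in>insert j J. c i * (x(j := t)) i) = c j * t + s c"
        using insert.hyps by simp
      consider "c j = 0" | "c j > 0" | "c j < 0" by linarith
      then have "c j * t + s c \<le> \<beta>"
      proof cases
        case 1
        then show ?thesis using x[of c \<beta>] that by (auto simp: C'_def Z_def s_def)
      next
        case 2
        then have "t \<le> bd (c, \<beta>)" using t(2) that by (auto simp: P_def)
        then show ?thesis using 2 by (simp add: bd_def field_simps)
      next
        case 3
        then have "bd (c, \<beta>) \<le> t" using t(1) that by (auto simp: N_def)
        then show ?thesis using 3 by (simp add: bd_def field_simps)
      qed
      then show ?thesis using eq by simp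
    qed
    then have "\<forall>(c, \<beta>) \<in> C. (\<Sum>i\<in>insert j J. c i * (x(j := t)) i) \<le> \<beta>"
      by blast
    then show False using insert.prems(4) by blast
  qed
  ultimately show ?case by (rule insert.IH)
qed

section \<open>Linear programming duality for the barycenter on a finite set\<close>

text \<open>These shapes of Kronecker deltas arise when unit multipliers are inserted into the rows
  of the linear system below.\<close>

lemma sum_mult_of_bool_conj_eq:
  fixes g :: "'a \<Rightarrow> real"
  assumes "finite A" "a \<in> A"
  shows "(\<Sum>x\<in>A. g x * of_bool (x = a)) = g a"
    and "(\<Sum>x\<in>A. g x * of_bool (P \<and> x = a)) = g a * of_bool P"
    and "(\<Sum>x\<in>A. g x * of_bool (P \<and> P' \<and> x = a)) = g a * of_bool (P \<and> P')"
    and "(\<Sum>x\<in>A. g x * of_bool (P \<and> x = a \<and> P')) = g a * of_bool (P \<and> P')"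
proof -
  show *: "(\<Sum>x\<in>A. g x * of_bool (x = a)) = g a"
    using assms by (simp add: of_bool_def if_distrib cong: if_cong)
  show "(\<Sum>x\<in>A. g x * of_bool (P \<and> x = a)) = g a * of_bool P" by (cases P) (simp_all add: *)
  show "(\<Sum>x\<in>A. g x * of_bool (P \<and> P' \<and> x = a)) = g a * of_bool (P \<and> P')"
    by (cases P; cases P') (simp_all add: *)
  show "(\<Sum>x\<in>A. g x * of_bool (P \<and> x = a \<and> P')) = g a * of_bool (P \<and> P')"
    by (cases P; cases P') (simp_all add: *)
qed

lemmas sum_of_bool_conj_eq = sum_mult_of_bool_conj_eq[where g = "\<lambda>_. 1", simplified]

text \<open>Linear programming duality at a prescribed level \<open>V\<close>. Each
  \<open>\<gamma> i\<close> is a partial plan whose marginals stay below \<open>m i\<close> and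
  \<open>n\<close>, and each unit of mass missing from either marginal costs \<open>u i\<close>.
  Farkas' lemma gives the alternative directly, without optimal solutions of either problem.\<close>

lemma discrete_barycenter_alternative:
  fixes c :: "'i \<Rightarrow> 'y \<Rightarrow> 'y \<Rightarrow> real" and u :: "'i \<Rightarrow> real" and m :: "'i \<Rightarrow> 'y \<Rightarrow> real" and V :: real
  assumes fin: "finite I" "finite Y" and "I \<noteq> {}"
    and c: "\<And>i y z. i \<in> I \<Longrightarrow> y \<in> Y \<Longrightarrow> z \<in> Y \<Longrightarrow> 0 \<le> c i y z" and u: "\<And>i. i \<in> I \<Longrightarrow> 0 \<le> u i"
  obtains (dual) \<phi> f where
      "\<And>i y z. i \<in> I \<Longrightarrow> y \<in> Y \<Longrightarrow> z \<in> Y \<Longrightarrow> \<phi> i y + f i z \<le> c i y z"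
      "\<And>i y. i \<in> I \<Longrightarrow> y \<in> Y \<Longrightarrow> \<phi> i y \<le> u i"
      "\<And>i y. i \<in> I \<Longrightarrow> y \<in> Y \<Longrightarrow> f i y \<le> u i"
      "\<And>y. y \<in> Y \<Longrightarrow> (\<Sum>i\<in>I. f i y) = 0"
      "V \<le> (\<Sum>i\<in>I. \<Sum>y\<in>Y. m i y * \<phi> i y)"
  | (primal) \<gamma> n where
      "\<And>i y z. i \<in> I \<Longrightarrow> y \<in> Y \<Longrightarrow> z \<in> Y \<Longrightarrow> 0 \<le> \<gamma> i y z"
      "\<And>i y. i \<in> I \<Longrightarrow> y \<in> Y \<Longrightarrow> (\<Sum>z\<in>Y. \<gamma> i y z) \<le> m i y"
      "\<And>i z. i \<in> I \<Longrightarrow> z \<in> Y \<Longrightarrow> (\<Sum>y\<in>Y. \<gamma> i y z) \<le> n z"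
      "(\<Sum>i\<in>I. (\<Sum>y\<in>Y. \<Sum>z\<in>Y. c i y z * \<gamma> i y z) + u i * (\<Sum>y\<in>Y. m i y - (\<Sum>z\<in>Y. \<gamma> i y z))
         + u i * (\<Sum>z\<in>Y. n z - (\<Sum>y\<in>Y. \<gamma> i y z))) < V"
proof -
  text \<open>The unknown \<open>Inl (i, y)\<close> stands for \<open>\<phi> i y\<close> and \<open>Inr (i, z)\<close> for \<open>f i z\<close>.\<close>
  define J :: "('i \<times> 'y + 'i \<times> 'y) set" where "J = (I \<times> Y) <+> (I \<times> Y)"
  define e where "e k = (\<lambda>j. of_bool (j = k) :: real)" for k :: "'i \<times> 'y + 'i \<times> 'y"
  \<comment> \<open>A pair stands for the inequality with these coefficients and this right-hand
    side. The rows \<open>C4\<close> only ask for a nonnegative sum of the \<open>f i\<close>,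
    equality being restored afterwards; \<open>c5\<close> asks for a dual objective of at least
    \<open>V\<close>.\<close>
  define C1 where "C1 = (\<lambda>(i, y, z). (\<lambda>j. e (Inl (i, y)) j + e (Inr (i, z)) j, c i y z)) ` (I \<times> Y \<times> Y)"
  define C2 where "C2 = (\<lambda>(i, y). (e (Inl (i, y)), u i)) ` (I \<times> Y)"
  define C3 where "C3 = (\<lambda>(i, y). (e (Inr (i, y)), u i)) ` (I \<times> Y)"
  define C4 where "C4 = (\<lambda>y. (\<lambda>j. - (\<Sum>i\<in>I. e (Inr (i, y)) j), 0 :: real)) ` Y"
  define c5 where "c5 j = - (\<Sum>i\<in>I. \<Sum>y\<in>Y. m i y * e (Inl (i, y)) j)" for j
  define C where "C = C1 \<union> C2 \<union> C3 \<union> C4 \<union> {(c5, - V)}"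
  \<comment> \<open>The witnesses are the multipliers of the rows: \<open>\<gamma>\<close> of
    \<open>C1\<close>, \<open>s\<close> of \<open>C2\<close>, \<open>t\<close> of \<open>C3\<close>,
    \<open>n\<close> of \<open>C4\<close> and \<open>\<theta>\<close> of \<open>c5\<close>;
    \<open>g\<close> and \<open>\<beta>\<close> are the resulting coefficients and right-hand side.
    In the primal reading \<open>s\<close> and \<open>t\<close> are the unmatched masses on the two
    sides, and \<open>\<theta>\<close> homogenizes the data \<open>m\<close> and
    \<open>V\<close>.\<close>
  define feas where "feas g \<beta> \<gamma> s t n \<theta> \<longleftrightarrow> (\<forall>i\<in>I. \<forall>y\<in>Y. \<forall>z\<in>Y. 0 \<le> \<gamma> i y z)
      \<and> (\<forall>i\<in>I. \<forall>y\<in>Y. 0 \<le> s i y) \<and> (\<forall>i\<in>I. \<forall>y\<in>Y. 0 \<le> t i y) \<and> 0 \<le> \<theta>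
      \<and> (\<forall>i\<in>I. \<forall>y\<in>Y. g (Inl (i, y)) = (\<Sum>z\<in>Y. \<gamma> i y z) + s i y - \<theta> * m i y)
      \<and> (\<forall>i\<in>I. \<forall>z\<in>Y. g (Inr (i, z)) = (\<Sum>y\<in>Y. \<gamma> i y z) + t i z - n z)
      \<and> \<beta> = (\<Sum>i\<in>I. (\<Sum>y\<in>Y. \<Sum>z\<in>Y. c i y z * \<gamma> i y z) + u i * (\<Sum>y\<in>Y. s i y)
           + u i * (\<Sum>z\<in>Y. t i z)) - \<theta> * V"
    for g \<beta> \<gamma> s t n \<theta>
  define Q where "Q = {(g, \<beta>). \<exists>\<gamma> s t n \<theta>. feas g \<beta> \<gamma> s t n \<theta>}"
  have finJ: "finite J" "finite C" using fin by (auto simp: J_def C_def C1_def C2_def C3_def C4_def)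
  have sel: "(\<Sum>j\<in>J. e k j * x j) = x k" if "k \<in> J" for k x
  proof -
    have "(\<Sum>j\<in>J. e k j * x j) = (\<Sum>j\<in>J. x j * of_bool (j = k))"
      by (simp add: e_def mult.commute)
    then show ?thesis using that finJ by (simp add: sum_mult_of_bool_conj_eq)
  qed
  have J: "Inl (i, y) \<in> J \<longleftrightarrow> i \<in> I \<and> y \<in> Y" "Inr (i, y) \<in> J \<longleftrightarrow> i \<in> I \<and> y \<in> Y" for i y
    by (auto simp: J_def)
  have inC: "((\<lambda>j. e (Inl (i, y)) j + e (Inr (i, z)) j), c i y z) \<in> C"
      "(e (Inl (i, y)), u i) \<in> C" "(e (Inr (i, y)), u i) \<in> C"
      "((\<lambda>j. - (\<Sum>i\<in>I. e (Inr (i, y)) j)), 0) \<in> C"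
    if "i \<in> I" "y \<in> Y" "z \<in> Y" for i y z
  proof -
    have sub: "C1 \<subseteq> C" "C2 \<subseteq> C" "C3 \<subseteq> C" "C4 \<subseteq> C" unfolding C_def by blast+
    show "((\<lambda>j. e (Inl (i, y)) j + e (Inr (i, z)) j), c i y z) \<in> C"
      by (rule subsetD[OF sub(1)], unfold C1_def, rule image_eqI[of _ _ "(i, y, z)"])
        (simp_all add: that)
    show "(e (Inl (i, y)), u i) \<in> C"
      by (rule subsetD[OF sub(2)], unfold C2_def, rule image_eqI[of _ _ "(i, y)"])
        (simp_all add: that)
    show "(e (Inr (i, y)), u i) \<in> C"
      by (rule subsetD[OF sub(3)], unfold C3_def, rule image_eqI[of _ _ "(i, y)"])
        (simp_all add: that)
    show "((\<lambda>j. - (\<Sum>i\<in>I. e (Inr (i, y)) j)), 0) \<in> C"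
      by (rule subsetD[OF sub(4)], unfold C4_def, rule image_eqI[of _ _ y])
        (simp_all add: that)
  qed
  have e: "e (Inl p) (Inr q) = 0" "e (Inr p) (Inl q) = 0" for p q by (auto simp: e_def)
  have e_sym: "e k j = e j k" for j k by (auto simp: e_def)
  note delta = sum_mult_of_bool_conj_eq sum_of_bool_conj_eq
  show thesis
  proof (cases "\<exists>x. \<forall>(g, \<beta>) \<in> C. (\<Sum>j\<in>J. g j * x j) \<le> \<beta>")
    case True
    then obtain x where x: "\<And>g \<beta>. (g, \<beta>) \<in> C \<Longrightarrow> (\<Sum>j\<in>J. g j * x j) \<le> \<beta>" by auto
    have x1: "x (Inl (i, y)) + x (Inr (i, z)) \<le> c i y z" if "i \<in> I" "y \<in> Y" "z \<in> Y" for i y z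
    proof -
      from x[OF inC(1)[OF that]] show ?thesis using that by (simp add: distrib_right sum.distrib sel J)
    qed
    have x2: "x (Inl (i, y)) \<le> u i" "x (Inr (i, y)) \<le> u i" if "i \<in> I" "y \<in> Y" for i y
      using x[OF inC(2)[OF that that(2)]] x[OF inC(3)[OF that that(2)]] that
      by (simp_all add: sel J)
    have x4: "0 \<le> (\<Sum>i\<in>I. x (Inr (i, y)))" if "y \<in> Y" for y
    proof -
      obtain i0 where "i0 \<in> I" using \<open>I \<noteq> {}\<close> by auto
      from x[OF inC(4)[OF this that that]] have "0 \<le> (\<Sum>j\<in>J. \<Sum>i\<in>I. e (Inr (i, y)) j * x j)"
        by (simp add: sum_distrib_right sum_negf)
      also have "\<dots> = (\<Sum>i\<in>I. x (Inr (i, y)))"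
        by (subst sum.swap) (use that in \<open>simp add: sel J\<close>)
      finally show ?thesis .
    qed
    have x5: "V \<le> (\<Sum>i\<in>I. \<Sum>y\<in>Y. m i y * x (Inl (i, y)))"
    proof -
      have "(c5, - V) \<in> C" by (auto simp: C_def)
      from x[OF this] have "V \<le> (\<Sum>j\<in>J. \<Sum>i\<in>I. \<Sum>y\<in>Y. m i y * (e (Inl (i, y)) j * x j))"
        by (simp add: sum_distrib_right sum_negf c5_def mult.assoc)
      also have "\<dots> = (\<Sum>i\<in>I. \<Sum>j\<in>J. \<Sum>y\<in>Y. m i y * (e (Inl (i, y)) j * x j))"
        by (rule sum.swap)
      also have "\<dots> = (\<Sum>i\<in>I. \<Sum>y\<in>Y. \<Sum>j\<in>J. m i y * (e (Inl (i, y)) j * x j))"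
        by (intro sum.cong refl sum.swap)
      also have "\<dots> = (\<Sum>i\<in>I. \<Sum>y\<in>Y. m i y * x (Inl (i, y)))"
        by (simp add: sel J flip: sum_distrib_left)
      finally show ?thesis .
    qed
    obtain i0 where i0: "i0 \<in> I" using \<open>I \<noteq> {}\<close> by auto
    \<comment> \<open>The surplus of the sum is taken away from the single index \<open>i0\<close>.
      By \<open>x4\<close> it is nonnegative, so \<open>f\<close> only decreases and all upper
      bounds survive.\<close>
    define f where "f i y = x (Inr (i, y)) - (if i = i0 then \<Sum>i\<in>I. x (Inr (i, y)) else 0)" for i y
    have f: "f i y \<le> x (Inr (i, y))" if "y \<in> Y" for i y using x4[OF that] by (auto simp: f_def)
    show thesis
    proof (rule dual[of "\<lambda>i y. x (Inl (i, y))" f])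
      show "(\<Sum>i\<in>I. f i y) = 0" for y
        using i0 fin by (simp add: f_def sum_subtractf)
      show "x (Inl (i, y)) + f i z \<le> c i y z" if "i \<in> I" "y \<in> Y" "z \<in> Y" for i y z
        using x1[OF that] f[of z i] that by linarith
      show "f i y \<le> u i" if "i \<in> I" "y \<in> Y" for i y
        using x2(2)[OF that] f[of y i] that by linarith
    qed (use x2 x5 in auto)
  next
    case False
    have "\<exists>\<beta><0. (\<lambda>_. 0, \<beta>) \<in> Q"
    proof (rule farkas_infeasible[OF _ _ finJ _ _ False])
      fix g \<beta> g' \<beta>' assume "(g, \<beta>) \<in> Q" "(g', \<beta>') \<in> Q"
      then obtain \<gamma> s t n \<theta> \<gamma>' s' t' n' \<theta>' where
        "feas g \<beta> \<gamma> s t n \<theta>" "feas g' \<beta>' \<gamma>' s' t' n' \<theta>'" by (auto simp: Q_def)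
      then have "feas (\<lambda>j. g j + g' j) (\<beta> + \<beta>') (\<lambda>i y z. \<gamma> i y z + \<gamma>' i y z) (\<lambda>i y. s i y + s' i y)
          (\<lambda>i y. t i y + t' i y) (\<lambda>y. n y + n' y) (\<theta> + \<theta>')"
        by (simp add: feas_def sum.distrib distrib_left distrib_right)
      then show "(\<lambda>j. g j + g' j, \<beta> + \<beta>') \<in> Q" unfolding Q_def by blast
    next
      fix g \<beta> and r :: real assume "(g, \<beta>) \<in> Q" and r: "0 < r"
      then obtain \<gamma> s t n \<theta> where "feas g \<beta> \<gamma> s t n \<theta>" by (auto simp: Q_def)
      then have "feas (\<lambda>j. r * g j) (r * \<beta>) (\<lambda>i y z. r * \<gamma> i y z) (\<lambda>i y. r * s i y)
          (\<lambda>i y. r * t i y) (\<lambda>y. r * n y) (r * \<theta>)"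
        using r by (simp add: feas_def sum_distrib_left distrib_left right_diff_distrib mult_ac)
      then show "(\<lambda>j. r * g j, r * \<beta>) \<in> Q" unfolding Q_def by blast
    next
      \<comment> \<open>Each row is certified by taking its own multiplier equal to 1 and all others
        equal to 0.\<close>
      have "C1 \<subseteq> Q"
      proof (clarsimp simp: C1_def)
        fix i y z assume "i \<in> I" "y \<in> Y" "z \<in> Y"
        then have "feas (\<lambda>j. e (Inl (i, y)) j + e (Inr (i, z)) j) (c i y z)
            (\<lambda>i' y' z'. of_bool (i' = i \<and> y' = y \<and> z' = z))
            (\<lambda>_ _. 0) (\<lambda>_ _. 0) (\<lambda>_. 0) 0"
          using fin by (simp add: feas_def e_def delta del: sum_mult_of_bool_eq sum_of_bool_mult_eq sum_of_bool_eq)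
        then show "(\<lambda>j. e (Inl (i, y)) j + e (Inr (i, z)) j, c i y z) \<in> Q" unfolding Q_def by blast
      qed
      moreover have "C2 \<subseteq> Q"
      proof (clarsimp simp: C2_def)
        fix i y assume "i \<in> I" "y \<in> Y"
        then have "feas (e (Inl (i, y))) (u i) (\<lambda>_ _ _. 0)
            (\<lambda>i' y'. of_bool (i' = i \<and> y' = y)) (\<lambda>_ _. 0) (\<lambda>_. 0) 0"
          using fin by (simp add: feas_def e_def delta del: sum_mult_of_bool_eq sum_of_bool_mult_eq sum_of_bool_eq)
        then show "(e (Inl (i, y)), u i) \<in> Q" unfolding Q_def by blast
      qed
      moreover have "C3 \<subseteq> Q"
      proof (clarsimp simp: C3_def)
        fix i y assume "i \<in> I" "y \<in> Y"
        then have "feas (e (Inr (i, y))) (u i) (\<lambda>_ _ _. 0) (\<lambda>_ _. 0)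
            (\<lambda>i' y'. of_bool (i' = i \<and> y' = y)) (\<lambda>_. 0) 0"
          using fin by (simp add: feas_def e_def delta del: sum_mult_of_bool_eq sum_of_bool_mult_eq sum_of_bool_eq)
        then show "(e (Inr (i, y)), u i) \<in> Q" unfolding Q_def by blast
      qed
      moreover have "C4 \<subseteq> Q"
      proof (clarsimp simp: C4_def)
        fix y assume "y \<in> Y"
        moreover have "(\<Sum>i'\<in>I. e (Inr (i', y)) (Inr (i, z))) = (if z = y then 1 else 0)" if "i \<in> I" for i z
        proof -
          have "(\<Sum>i'\<in>I. e (Inr (i', y)) (Inr (i, z))) = (\<Sum>i'\<in>I. e (Inr (i, z)) (Inr (i', y)))"
            by (intro sum.cong refl e_sym)
          then show ?thesis using that fin by (auto simp: e_def delta simp del: sum_of_bool_eq)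
        qed
        ultimately have "feas (\<lambda>j. - (\<Sum>i\<in>I. e (Inr (i, y)) j)) 0 (\<lambda>_ _ _. 0) (\<lambda>_ _. 0)
            (\<lambda>_ _. 0) (\<lambda>y'. if y' = y then 1 else 0) 0"
          by (simp add: feas_def e)
        then show "(\<lambda>j. - (\<Sum>i\<in>I. e (Inr (i, y)) j), 0) \<in> Q" unfolding Q_def by blast
      qed
      moreover have "(c5, - V) \<in> Q"
      proof -
        have "c5 (Inl (i, y)) = - m i y" if "i \<in> I" "y \<in> Y" for i y
        proof -
          have "(\<Sum>i'\<in>I. \<Sum>y'\<in>Y. m i' y' * e (Inl (i', y')) (Inl (i, y)))
              = (\<Sum>i'\<in>I. \<Sum>y'\<in>Y. m i' y' * e (Inl (i, y)) (Inl (i', y')))"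
            by (intro sum.cong refl arg_cong2[where f = "(*)"] e_sym)
          then show ?thesis using that fin by (simp add: c5_def e_def delta del: sum_mult_of_bool_eq sum_of_bool_mult_eq sum_of_bool_eq)
        qed
        then have "feas c5 (- V) (\<lambda>_ _ _. 0) (\<lambda>_ _. 0) (\<lambda>_ _. 0) (\<lambda>_. 0) 1"
          by (simp add: feas_def) (simp add: c5_def e)
        then show ?thesis unfolding Q_def by blast
      qed
      ultimately show "C \<subseteq> Q" by (simp add: C_def)
    next
      fix g \<beta> j assume "(g, \<beta>) \<in> C" "j \<notin> J"
      then show "g j = 0"
        by (auto simp: C_def C1_def C2_def C3_def C4_def c5_def J e_def intro!: sum.neutral)
    qed
    then obtain \<beta> \<gamma> s t n \<theta> where "\<beta> < 0" and F: "feas (\<lambda>_. 0) \<beta> \<gamma> s t n \<theta>"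
      by (auto simp: Q_def)
    have s: "\<theta> * m i y = (\<Sum>z\<in>Y. \<gamma> i y z) + s i y" if "i \<in> I" "y \<in> Y" for i y
      using F that by (auto simp: feas_def)
    have t: "n z = (\<Sum>y\<in>Y. \<gamma> i y z) + t i z" if "i \<in> I" "z \<in> Y" for i z
      using F that unfolding feas_def by (metis eq_iff_diff_eq_0)
    have nn: "0 \<le> \<gamma> i y z" "0 \<le> s i y" "0 \<le> t i z" if "i \<in> I" "y \<in> Y" "z \<in> Y" for i y z
      using F that by (auto simp: feas_def)
    \<comment> \<open>\<open>R\<close> is the primal cost before normalization. Nonnegative prices
      give \<open>0 \<le> R < \<theta> * V\<close>, which excludes \<open>\<theta> = 0\<close>;
      division by \<open>\<theta>\<close> then produces the primal solution.\<close>
    define R where "R = (\<Sum>i\<in>I. (\<Sum>y\<in>Y. \<Sum>z\<in>Y. c i y z * \<gamma> i y z) + u i * (\<Sum>y\<in>Y. s i y)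
           + u i * (\<Sum>z\<in>Y. t i z))"
    have "0 \<le> R" unfolding R_def using c u nn
      by (intro sum_nonneg add_nonneg_nonneg mult_nonneg_nonneg) auto
    moreover have R: "R < \<theta> * V" using F \<open>\<beta> < 0\<close> by (simp add: feas_def R_def)
    moreover have "0 \<le> \<theta>" using F by (simp add: feas_def)
    ultimately have \<theta>: "0 < \<theta>" by (metis less_eq_real_def mult_zero_left not_less)
    show thesis
    proof (rule primal[of "\<lambda>i y z. \<gamma> i y z / \<theta>" "\<lambda>z. n z / \<theta>"])
      show "0 \<le> \<gamma> i y z / \<theta>" if "i \<in> I" "y \<in> Y" "z \<in> Y" for i y z
        using nn[OF that] \<theta> by simp
      show "(\<Sum>z\<in>Y. \<gamma> i y z / \<theta>) \<le> m i y" if "i \<in> I" "y \<in> Y" for i y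
        using s[OF that] nn[OF that that(2)] \<theta> by (simp add: field_simps flip: sum_divide_distrib)
      show "(\<Sum>y\<in>Y. \<gamma> i y z / \<theta>) \<le> n z / \<theta>" if "i \<in> I" "z \<in> Y" for i z
        using t[OF that] nn[OF that(1,2,2)] \<theta> by (simp add: divide_right_mono flip: sum_divide_distrib)
      have 1: "m i y - (\<Sum>z\<in>Y. \<gamma> i y z / \<theta>) = s i y / \<theta>" if "i \<in> I" "y \<in> Y" for i y
        using s[OF that] \<theta> by (simp add: field_simps flip: sum_divide_distrib)
      have 2: "n z / \<theta> - (\<Sum>y\<in>Y. \<gamma> i y z / \<theta>) = t i z / \<theta>" if "i \<in> I" "z \<in> Y" for i z
        using t[OF that] \<theta> by (simp add: field_simps flip: sum_divide_distrib)
      have "(\<Sum>i\<in>I. (\<Sum>y\<in>Y. \<Sum>z\<in>Y. c i y z * (\<gamma> i y z / \<theta>)) + u i * (\<Sum>y\<in>Y. m i y - (\<Sum>z\<in>Y. \<gamma> i y z / \<theta>))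
           + u i * (\<Sum>z\<in>Y. n z / \<theta> - (\<Sum>y\<in>Y. \<gamma> i y z / \<theta>))) = R / \<theta>"
        unfolding R_def by (simp add: 1 2 sum_divide_distrib add_divide_distrib sum_distrib_left)
      also have "R / \<theta> < V" using R \<theta> by (simp add: field_simps)
      finally show "(\<Sum>i\<in>I. (\<Sum>y\<in>Y. \<Sum>z\<in>Y. c i y z * (\<gamma> i y z / \<theta>)) + u i * (\<Sum>y\<in>Y. m i y - (\<Sum>z\<in>Y. \<gamma> i y z / \<theta>))
           + u i * (\<Sum>z\<in>Y. n z / \<theta> - (\<Sum>y\<in>Y. \<gamma> i y z / \<theta>))) < V" .
    qed
  qed
qed

section \<open>Supports, integrals and total variation of finite Borel measures\<close>

lemma finite_borel_measuresD:
  assumes "M \<in> finite_borel_measures"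
  shows "sets M = sets borel" "space M = UNIV" "finite_measure M"
  using assms sets_eq_imp_space_eq[of M borel] by (simp_all add: finite_borel_measures_def)

lemma finite_borel_measures_integrable:
  fixes g :: "'a::topological_space \<Rightarrow> real"
  assumes "M \<in> finite_borel_measures" "g \<in> borel_measurable borel" "\<And>x. \<bar>g x\<bar> \<le> c"
  shows "integrable M g"
proof (rule finite_measure.integrable_const_bound[where B = c])
  show "g \<in> borel_measurable M"
    unfolding measurable_cong_sets[OF finite_borel_measuresD(1)[OF assms(1)] refl] by (rule assms(2))
qed (use assms finite_borel_measuresD in auto)

text \<open>The complement of the support is the union of all open null sets, and by the Lindelof
  property countably many of them already cover it.\<close>

lemma emeasure_compl_supp_measure:
  fixes M :: "'a::second_countable_topology measure"
  assumes "sets M = sets borel"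
  shows "closed (supp_measure M)" "emeasure M (- supp_measure M) = 0"
proof -
  define F where "F = {U. open U \<and> emeasure M U = 0}"
  have F: "- supp_measure M = \<Union>F"
    by (auto simp: supp_measure_def F_def)
  show "closed (supp_measure M)"
    unfolding closed_def F by (rule open_Union) (auto simp: F_def)
  obtain F' where F': "F' \<subseteq> F" "countable F'" "\<Union>F' = \<Union>F"
    using Lindelof[of F] by (auto simp: F_def)
  then have "\<Union>F' \<in> null_sets M"
    using assms by (intro null_sets_UN'[of F' id M, simplified]) (auto simp: F_def null_sets_def)
  then show "emeasure M (- supp_measure M) = 0" by (simp add: F F' null_sets_def)
qed

lemma supp_measure_subset_closed:
  assumes "closed K" "emeasure M (- K) = 0"
  shows "supp_measure M \<subseteq> K"
  using assms by (force simp: supp_measure_def closed_def)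

text \<open>An identity between differences of measures is put as one between sums, since
  subtraction of extended nonnegative numbers is truncated. It carries the defining equation of a
  Jordan decomposition from sets over to integrals.\<close>

lemma nn_integral_eq_of_add_emeasure_eq:
  assumes sets: "sets M2 = sets M1" "sets N1 = sets M1" "sets N2 = sets M1"
    and eq: "\<And>A. A \<in> sets M1 \<Longrightarrow> emeasure M1 A + emeasure M2 A = emeasure N1 A + emeasure N2 A"
    and f: "f \<in> borel_measurable M1"
  shows "nn_integral M1 f + nn_integral M2 f = nn_integral N1 f + nn_integral N2 f"
proof -
  have space: "space M2 = space M1" "space N1 = space M1" "space N2 = space M1"
    using sets by (auto dest: sets_eq_imp_space_eq)
  have meas: "borel_measurable M2 = borel_measurable M1" "borel_measurable N1 = borel_measurable M1"
    "borel_measurable N2 = borel_measurable M1"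
    using sets by (simp_all cong: measurable_cong_sets)
  show ?thesis
    using f
  proof (induction rule: borel_measurable_induct)
    case (cong f g)
    then have "nn_integral L f = nn_integral L g" if "L \<in> {M1, M2, N1, N2}" for L
      using that space by (intro nn_integral_cong) auto
    then show ?case using cong by simp
  next
    case (set A)
    then show ?case using eq sets by simp
  next
    case (mult u c)
    then show ?case by (simp add: nn_integral_cmult meas flip: distrib_left)
  next
    case (add u v)
    then show ?case by (simp add: nn_integral_add meas) (metis add.assoc add.left_commute)
  next
    case (seq U)
    have SUP: "nn_integral L (Sup (range U)) = (SUP i. nn_integral L (U i))" if "L \<in> {M1, M2, N1, N2}" for L
      unfolding Sup_apply image_image
      using that seq by (intro nn_integral_monotone_convergence_SUP) (auto simp: meas)
    have inc: "incseq (\<lambda>i. nn_integral L (U i))" for L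
      using seq by (auto simp: incseq_def le_fun_def intro!: nn_integral_mono)
    have "nn_integral A (Sup (range U)) + nn_integral B (Sup (range U))
        = (SUP i. nn_integral A (U i) + nn_integral B (U i))"
      if "A \<in> {M1, M2, N1, N2}" "B \<in> {M1, M2, N1, N2}" for A B
      unfolding SUP[OF that(1)] SUP[OF that(2)] by (rule ennreal_SUP_add[symmetric]) (rule inc)+
    then show ?case using seq by (simp del: Sup_apply SUP_apply)
  qed
qed

lemma signed_norm_diff_nonneg:
  assumes "M \<in> finite_borel_measures" "N \<in> finite_borel_measures"
  shows "0 \<le> signed_norm (\<lambda>A. measure M A - measure N A)"
  using jordan_decomposition_diff_exists[OF assms] by (auto simp: signed_norm_eq)

text \<open>With Jordan parts \<open>P\<close> and \<open>Q\<close>, the left-hand side is the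
  integral of \<open>g\<close> against \<open>P\<close> minus the one against \<open>Q\<close>, and
  each is at most \<open>c\<close> times the mass in absolute value. This is how a bounded potential
  is tested against a total variation term.\<close>

lemma integral_diff_le_signed_norm:
  fixes g :: "'a::topological_space \<Rightarrow> real"
  assumes M: "M \<in> finite_borel_measures" and N: "N \<in> finite_borel_measures"
    and g: "g \<in> borel_measurable borel" "\<And>x. \<bar>g x\<bar> \<le> c"
  shows "integral\<^sup>L M g - integral\<^sup>L N g \<le> c * signed_norm (\<lambda>A. measure M A - measure N A)"
proof -
  obtain P Q where J: "jordan_decomposition (\<lambda>A. measure M A - measure N A) P Q"
    using jordan_decomposition_diff_exists[OF M N] by auto
  then have PQ: "P \<in> finite_borel_measures" "Q \<in> finite_borel_measures"
    and eq: "\<And>A. A \<in> sets borel \<Longrightarrow> measure M A + measure Q A = measure N A + measure P A"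
    by (auto simp: jordan_decomposition_def algebra_simps)
  note fb = finite_borel_measuresD[OF M] finite_borel_measuresD[OF N]
    finite_borel_measuresD[OF PQ(1)] finite_borel_measuresD[OF PQ(2)]
  \<comment> \<open>The shift by \<open>c\<close> makes the integrand nonnegative, as extended
    integrals require. It cancels in the end because \<open>M\<close> and \<open>Q\<close> together
    have the same mass as \<open>N\<close> and \<open>P\<close>.\<close>
  define h where "h x = g x + c" for x
  have h: "h \<in> borel_measurable borel" "\<And>x. 0 \<le> h x" "\<And>x. \<bar>h x\<bar> \<le> 2 * c"
    using g(1) g(2)[THEN abs_le_D1] g(2)[THEN abs_le_D2] unfolding h_def
    by (auto simp: abs_le_iff) (smt (verit))+
  have nn: "nn_integral L (\<lambda>x. ennreal (h x)) = ennreal (integral\<^sup>L L h)"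
    if "L \<in> finite_borel_measures" for L
    using h finite_borel_measures_integrable[OF that h(1,3)] by (intro nn_integral_eq_integral) auto
  have lin: "integral\<^sup>L L h = integral\<^sup>L L g + c * measure L UNIV" if "L \<in> finite_borel_measures" for L
  proof -
    interpret L: finite_measure L using finite_borel_measuresD[OF that] by auto
    show ?thesis
      using finite_borel_measures_integrable[OF that g] finite_borel_measuresD[OF that]
      by (simp add: h_def[abs_def])
  qed
  have nonneg: "0 \<le> integral\<^sup>L L h" for L using h by (intro integral_nonneg_AE) auto
  have "nn_integral M (\<lambda>x. ennreal (h x)) + nn_integral Q (\<lambda>x. ennreal (h x))
      = nn_integral N (\<lambda>x. ennreal (h x)) + nn_integral P (\<lambda>x. ennreal (h x))"
  proof (rule nn_integral_eq_of_add_emeasure_eq)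
    fix A assume "A \<in> sets M"
    then have "measure M A + measure Q A = measure N A + measure P A" using eq fb by simp
    then show "emeasure M A + emeasure Q A = emeasure N A + emeasure P A"
      using fb(3,6,9,12) by (simp add: finite_measure.emeasure_eq_measure flip: ennreal_plus)
  next
    show "(\<lambda>x. ennreal (h x)) \<in> borel_measurable M"
      using h(1) unfolding measurable_cong_sets[OF fb(1) refl] by measurable
  qed (use fb in simp_all)
  then have "integral\<^sup>L M h + integral\<^sup>L Q h = integral\<^sup>L N h + integral\<^sup>L P h"
    using nonneg by (simp add: nn M N PQ add_nonneg_nonneg flip: ennreal_plus)
  moreover have "\<bar>integral\<^sup>L L g\<bar> \<le> c * measure L UNIV" if "L \<in> finite_borel_measures" for L
  proof -
    interpret L: finite_measure L using finite_borel_measuresD[OF that] by auto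
    have "\<bar>integral\<^sup>L L g\<bar> \<le> integral\<^sup>L L (\<lambda>x. \<bar>g x\<bar>)" by (rule integral_abs_bound)
    also have "\<dots> \<le> integral\<^sup>L L (\<lambda>x. c)"
      using finite_borel_measures_integrable[OF that g] g by (intro integral_mono) auto
    finally show ?thesis using finite_borel_measuresD[OF that] by (simp add: mult.commute)
  qed
  from this[OF PQ(1)] this[OF PQ(2)] have "integral\<^sup>L P g - integral\<^sup>L Q g \<le> c * (measure P UNIV + measure Q UNIV)"
    by (simp add: algebra_simps abs_le_iff)
  moreover have "c * measure M UNIV + c * measure Q UNIV = c * measure N UNIV + c * measure P UNIV"
    using eq[of UNIV] by (simp flip: distrib_left)
  ultimately show ?thesis
    unfolding signed_norm_eq[OF J] lin[OF M] lin[OF N] lin[OF PQ(1)] lin[OF PQ(2)] by linarith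
qed

text \<open>The negative part is carried by \<open>- D\<close>, where domination makes the
  difference nonnegative. So it vanishes, and the norm is a difference of masses.\<close>

lemma signed_norm_diff_dominated:
  assumes M: "M \<in> finite_borel_measures" and N: "N \<in> finite_borel_measures"
    and le: "\<And>A. A \<in> sets borel \<Longrightarrow> measure N A \<le> measure M A"
  shows "signed_norm (\<lambda>A. measure M A - measure N A) = measure M UNIV - measure N UNIV"
proof -
  obtain P Q where J: "jordan_decomposition (\<lambda>A. measure M A - measure N A) P Q"
    using jordan_decomposition_diff_exists[OF M N] by auto
  then obtain D where D: "D \<in> sets borel" "emeasure P (- D) = 0" "emeasure Q D = 0"
    and eq: "\<And>A. A \<in> sets borel \<Longrightarrow> measure M A - measure N A = measure P A - measure Q A"
    by (auto simp: jordan_decomposition_def)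
  have "measure M (- D) - measure N (- D) = - measure Q UNIV"
    using jordan_decomposition_measures(2)[OF J D, of UNIV] by (simp add: Compl_eq_Diff_UNIV)
  then have "measure Q UNIV = 0"
    using le[of "- D"] D measure_nonneg[of Q UNIV] borel_comp[of D] by linarith
  then show ?thesis using eq[of UNIV] by (simp add: signed_norm_eq[OF J])
qed

section \<open>Weak duality for the Wasserstein and the generalized Wasserstein distance\<close>

lemma W2_squared:
  "(W2 \<mu>1 \<mu>2)\<^sup>2 = measure \<mu>1 UNIV *
     enn2real (INF \<pi> \<in> transport_plans \<mu>1 \<mu>2. \<integral>\<^sup>+ (x, y). ennreal ((dist x y)\<^sup>2) \<partial>\<pi>)"
  by (simp add: W2_def)

text \<open>A real \<open>Inf\<close> is informative only for a nonempty set that is bounded below.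
  The pair of null measures gives an element, and nonnegativity lets the square undo
  \<open>sqrt\<close>.\<close>

lemma gen_wasserstein_squared:
  fixes b :: real and \<mu>1 \<mu>2 :: "'a::metric_space measure"
  assumes "a \<ge> 0" "\<mu>1 \<in> finite_borel_measures" "\<mu>2 \<in> finite_borel_measures"
  defines "S \<equiv> {a * signed_norm (\<lambda>A. measure \<mu>1 A - measure \<nu>1 A) +
      a * signed_norm (\<lambda>A. measure \<mu>2 A - measure \<nu>2 A) + b\<^sup>2 * (W2 \<nu>1 \<nu>2)\<^sup>2 | \<nu>1 \<nu>2.
      \<nu>1 \<in> finite_borel_measures2 \<and> \<nu>2 \<in> finite_borel_measures2 \<and>
      measure \<nu>1 UNIV = measure \<nu>2 UNIV}"
  shows "(gen_wasserstein a b \<mu>1 \<mu>2)\<^sup>2 = Inf S" "S \<noteq> {}" "\<And>s. s \<in> S \<Longrightarrow> 0 \<le> s"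
proof -
  have "null_measure borel \<in> (finite_borel_measures2 :: 'a measure set)"
    by (auto simp: finite_borel_measures2_def finite_borel_measures_def intro!: finite_measureI)
  then show ne: "S \<noteq> {}" unfolding S_def by blast
  show nn: "0 \<le> s" if "s \<in> S" for s
    using that assms(1-3) unfolding S_def
    by (auto simp: finite_borel_measures2_def intro!: add_nonneg_nonneg mult_nonneg_nonneg
        signed_norm_diff_nonneg)
  have "0 \<le> Inf S" using ne nn by (intro cInf_greatest)
  then show "(gen_wasserstein a b \<mu>1 \<mu>2)\<^sup>2 = Inf S"
    by (simp add: gen_wasserstein_def S_def)
qed

lemma gen_wasserstein_squared_le:
  assumes "a \<ge> 0" "\<mu>1 \<in> finite_borel_measures" "\<mu>2 \<in> finite_borel_measures"
    and "\<nu>1 \<in> finite_borel_measures2" "\<nu>2 \<in> finite_borel_measures2" "measure \<nu>1 UNIV = measure \<nu>2 UNIV"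
  shows "(gen_wasserstein a b \<mu>1 \<mu>2)\<^sup>2 \<le> a * signed_norm (\<lambda>A. measure \<mu>1 A - measure \<nu>1 A) +
      a * signed_norm (\<lambda>A. measure \<mu>2 A - measure \<nu>2 A) + b\<^sup>2 * (W2 \<nu>1 \<nu>2)\<^sup>2"
  unfolding gen_wasserstein_squared(1)[OF assms(1-3)]
  using gen_wasserstein_squared(3)[OF assms(1-3), of _ b] assms(4-)
  by (intro cInf_lower bdd_belowI[where m = 0]) blast+

text \<open>\<open>M\<close> is the image of the plan under \<open>h\<close>, scaled by the mass of
  \<open>M\<close> because plans are normalized to probability measures. Both projections are
  instances of \<open>h\<close>.\<close>

lemma transport_plan_marginal_integral:
  fixes g :: "'a::polish_space \<Rightarrow> real"
  assumes \<pi>: "sets \<pi> = sets (borel :: ('a \<times> 'a) measure)" "prob_space \<pi>"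
    and h: "h \<in> borel_measurable borel"
    and M: "M \<in> finite_borel_measures"
    and marg: "\<And>A. A \<in> sets borel \<Longrightarrow> measure M UNIV * measure \<pi> (h -` A) = measure M A"
    and g: "g \<in> borel_measurable borel" "\<And>x. \<bar>g x\<bar> \<le> c"
  shows "integral\<^sup>L M g = measure M UNIV * integral\<^sup>L \<pi> (\<lambda>w. g (h w))"
proof -
  interpret M: finite_measure M using finite_borel_measuresD[OF M] by auto
  interpret \<pi>: prob_space \<pi> by (rule \<pi>)
  have sp: "space \<pi> = UNIV" using \<pi>(1) by (auto dest: sets_eq_imp_space_eq)
  have hm: "h \<in> measurable \<pi> borel" using h \<pi>(1) by (simp cong: measurable_cong_sets)
  define m where "m = measure M UNIV"
  have m: "0 \<le> m" by (simp add: m_def)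
  have "M = density (distr \<pi> borel h) (\<lambda>_. ennreal m)"
  proof (rule measure_eqI)
    fix A assume "A \<in> sets M"
    then have A: "A \<in> sets borel" using finite_borel_measuresD[OF M] by auto
    then show "emeasure M A = emeasure (density (distr \<pi> borel h) (\<lambda>_. ennreal m)) A"
      using marg[OF A] hm m sp
      by (simp add: emeasure_density nn_integral_cmult emeasure_distr M.emeasure_eq_measure
          \<pi>.emeasure_eq_measure m_def flip: ennreal_mult)
  qed (use finite_borel_measuresD[OF M] in simp)
  then have "integral\<^sup>L M g = integral\<^sup>L (density (distr \<pi> borel h) (\<lambda>_. ennreal m)) g" by simp
  also have "\<dots> = m * integral\<^sup>L \<pi> (\<lambda>w. g (h w))"
    using g(1) hm m by (simp add: integral_density integral_distr)
  finally show ?thesis by (simp add: m_def)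
qed

text \<open>Integrating the pointwise constraint against any plan gives the bound. The potentials
  are bounded, hence integrable for every plan, whether or not its cost is finite.\<close>

lemma W2_weak_duality:
  fixes \<phi> \<psi> :: "'a::polish_space \<Rightarrow> real"
  assumes M: "M \<in> finite_borel_measures2" and N: "N \<in> finite_borel_measures2"
    and mass: "measure M UNIV = measure N UNIV"
    and \<phi>: "\<phi> \<in> borel_measurable borel" "\<And>x. \<bar>\<phi> x\<bar> \<le> c"
    and \<psi>: "\<psi> \<in> borel_measurable borel" "\<And>x. \<bar>\<psi> x\<bar> \<le> c"
    and l: "0 < l" and le: "\<And>x y. \<phi> x + \<psi> y \<le> l * (dist x y)\<^sup>2"
  shows "integral\<^sup>L M \<phi> + integral\<^sup>L N \<psi> \<le> l * (W2 M N)\<^sup>2"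
proof -
  have M1: "M \<in> finite_borel_measures" and N1: "N \<in> finite_borel_measures"
    using M N by (auto simp: finite_borel_measures2_def)
  define m where "m = measure M UNIV"
  define T where "T = (INF \<pi> \<in> transport_plans M N. \<integral>\<^sup>+ (x, y). ennreal ((dist x y)\<^sup>2) \<partial>\<pi>)"
  have fin: "T < \<infinity>" unfolding T_def by (rule transport_cost_finite[OF M N mass])
  define L where "L = integral\<^sup>L M \<phi> + integral\<^sup>L N \<psi>"
  \<comment> \<open>The bound stays in the extended nonnegative reals, so plans of infinite cost are
    covered; a negative \<open>L'\<close> becomes 0 there, which is harmless.\<close>
  have key: "\<exists>L'. L = m * L' \<and> ennreal L' \<le> ennreal l * (\<integral>\<^sup>+ (x, y). ennreal ((dist x y)\<^sup>2) \<partial>\<pi>)"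
    if "\<pi> \<in> transport_plans M N" for \<pi>
  proof -
    have \<pi>: "sets \<pi> = sets borel" "prob_space \<pi>"
      "\<And>A. A \<in> sets borel \<Longrightarrow> m * measure \<pi> (A \<times> UNIV) = measure M A"
      "\<And>A. A \<in> sets borel \<Longrightarrow> m * measure \<pi> (UNIV \<times> A) = measure N A"
      using that mass by (auto simp: transport_plans_def m_def)
    interpret \<pi>: prob_space \<pi> by (rule \<pi>)
    have mb: "borel_measurable \<pi> = borel_measurable borel"
      using \<pi>(1) by (simp cong: measurable_cong_sets)
    have fst: "fst \<in> borel_measurable (borel :: ('a \<times> 'a) measure)"
      and snd: "snd \<in> borel_measurable (borel :: ('a \<times> 'a) measure)"
      by (auto intro!: borel_measurable_continuous_onI continuous_intros)
    have meas: "(\<lambda>w::'a\<times>'a. \<phi> (fst w)) \<in> borel_measurable borel" "(\<lambda>w::'a\<times>'a. \<psi> (snd w)) \<in> borel_measurable borel"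
      using measurable_compose[OF fst \<phi>(1)] measurable_compose[OF snd \<psi>(1)] by auto
    have int: "integrable \<pi> (\<lambda>w. \<phi> (fst w))" "integrable \<pi> (\<lambda>w. \<psi> (snd w))"
      using meas \<phi> \<psi> mb by (auto intro!: \<pi>.integrable_const_bound[where B = c])
    have "integral\<^sup>L M \<phi> = m * integral\<^sup>L \<pi> (\<lambda>w. \<phi> (fst w))"
      unfolding m_def
      using \<pi>(3) by (intro transport_plan_marginal_integral[OF \<pi>(1,2) fst M1 _ \<phi>])
        (simp add: m_def fst_vimage_eq_Times)
    moreover have "integral\<^sup>L N \<psi> = m * integral\<^sup>L \<pi> (\<lambda>w. \<psi> (snd w))"
      unfolding m_def mass
      using \<pi>(4) by (intro transport_plan_marginal_integral[OF \<pi>(1,2) snd N1 _ \<psi>])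
        (simp add: m_def mass snd_vimage_eq_Times)
    ultimately have L: "L = m * integral\<^sup>L \<pi> (\<lambda>w. \<phi> (fst w) + \<psi> (snd w))"
      using int by (simp add: L_def distrib_left)
    have dm: "(\<lambda>w::'a\<times>'a. ennreal ((dist (fst w) (snd w))\<^sup>2)) \<in> borel_measurable \<pi>"
      unfolding mb by (intro measurable_compose[OF _ measurable_ennreal]
          borel_measurable_continuous_onI continuous_intros)
    have "integral\<^sup>L \<pi> (\<lambda>w. \<phi> (fst w) + \<psi> (snd w))
        \<le> integral\<^sup>L \<pi> (\<lambda>w. max 0 (\<phi> (fst w) + \<psi> (snd w)))"
      using int by (intro integral_mono) auto
    then have "ennreal (integral\<^sup>L \<pi> (\<lambda>w. \<phi> (fst w) + \<psi> (snd w)))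
        \<le> ennreal (integral\<^sup>L \<pi> (\<lambda>w. max 0 (\<phi> (fst w) + \<psi> (snd w))))"
      by (rule ennreal_leI)
    also have "\<dots> = (\<integral>\<^sup>+ w. ennreal (max 0 (\<phi> (fst w) + \<psi> (snd w))) \<partial>\<pi>)"
      using int by (intro nn_integral_eq_integral[symmetric]) auto
    also have "\<dots> = (\<integral>\<^sup>+ w. ennreal (\<phi> (fst w) + \<psi> (snd w)) \<partial>\<pi>)"
      by (intro nn_integral_cong) (simp add: max_def ennreal_neg)
    also have "\<dots> \<le> (\<integral>\<^sup>+ w. ennreal l * ennreal ((dist (fst w) (snd w))\<^sup>2) \<partial>\<pi>)"
      using le l by (intro nn_integral_mono) (auto simp flip: ennreal_mult intro!: ennreal_leI)
    also have "\<dots> = ennreal l * (\<integral>\<^sup>+ (x, y). ennreal ((dist x y)\<^sup>2) \<partial>\<pi>)"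
      unfolding case_prod_beta by (rule nn_integral_cmult) (rule dm)
    finally show ?thesis using L by blast
  qed
  show ?thesis
  proof (cases "m = 0")
    case True
    \<comment> \<open>The infimum over no plans would be infinite, so finiteness of \<open>T\<close>
      supplies a plan, and \<open>key\<close> then gives \<open>L = 0\<close>.\<close>
    have "transport_plans M N \<noteq> {}" using fin by (auto simp: T_def)
    then have "L = 0" using key True by auto
    then show ?thesis using l by (simp add: L_def)
  next
    case False
    then have m: "0 < m" by (simp add: m_def measure_nonneg order_less_le)
    have "ennreal (L / m / l) \<le> T"
      unfolding T_def
    proof (rule INF_greatest)
      fix \<pi> assume "\<pi> \<in> transport_plans M N"
      from key[OF this] m have "ennreal (L / m) \<le> ennreal l * (\<integral>\<^sup>+ (x, y). ennreal ((dist x y)\<^sup>2) \<partial>\<pi>)"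
        (is "_ \<le> _ * ?I") by auto
      then have "ennreal (1 / l) * ennreal (L / m) \<le> ennreal (1 / l) * (ennreal l * ?I)"
        by (rule mult_left_mono) simp
      also have "\<dots> = ?I" using l by (simp add: mult.assoc[symmetric] flip: ennreal_mult)
      finally show "ennreal (L / m / l) \<le> ?I"
        using l by (simp add: ennreal_mult'[symmetric] mult.commute)
    qed
    then have "L / m / l \<le> enn2real T"
      using fin by (cases T) (auto simp: ennreal_le_iff2)
    then have "L \<le> l * (m * enn2real T)" using m l by (simp add: field_simps)
    then show ?thesis by (simp add: W2_squared L_def T_def m_def)
  qed
qed

text \<open>Discrete solutions yield plans that carry the actual mass. Normalizing by
  \<open>1 / m\<close> is compensated by the mass factor in \<open>W2\<close>.\<close>

lemma W2_le_of_plan: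
  fixes M N :: "'a::polish_space measure"
  assumes \<gamma>: "sets \<gamma> = sets borel" "finite_measure \<gamma>"
    and M: "\<And>A. A \<in> sets borel \<Longrightarrow> measure \<gamma> (A \<times> UNIV) = measure M A"
    and N: "\<And>A. A \<in> sets borel \<Longrightarrow> measure \<gamma> (UNIV \<times> A) = measure N A"
    and cost: "(\<integral>\<^sup>+ (x, y). ennreal ((dist x y)\<^sup>2) \<partial>\<gamma>) \<le> ennreal C" and C: "0 \<le> C"
  shows "(W2 M N)\<^sup>2 \<le> C"
proof (cases "measure M UNIV = 0")
  case False
  define m where "m = measure M UNIV"
  have m: "0 < m" using False by (simp add: m_def measure_nonneg order_less_le)
  have mass: "measure \<gamma> UNIV = m" "measure N UNIV = m" using M[of UNIV] N[of UNIV] by (simp_all add: m_def)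
  interpret \<gamma>: finite_measure \<gamma> by (rule \<gamma>)
  have sp: "space \<gamma> = UNIV" using \<gamma>(1) by (auto dest: sets_eq_imp_space_eq)
  let ?\<pi> = "scale_measure (ennreal (1 / m)) \<gamma>"
  have "prob_space ?\<pi>"
    using m mass by (intro prob_spaceI) (simp add: sp space_scale_measure \<gamma>.emeasure_eq_measure flip: ennreal_mult)
  then have plan: "?\<pi> \<in> transport_plans M N"
    using \<gamma>(1) m M N by (auto simp: transport_plans_def mass simp flip: m_def)
  have dm: "(\<lambda>(x, y). ennreal ((dist x y)\<^sup>2)) \<in> borel_measurable \<gamma>"
    unfolding measurable_cong_sets[OF \<gamma>(1) refl] case_prod_beta
    by (intro measurable_compose[OF _ measurable_ennreal]
          borel_measurable_continuous_onI continuous_intros)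
  let ?T = "INF \<pi> \<in> transport_plans M N. \<integral>\<^sup>+ (x, y). ennreal ((dist x y)\<^sup>2) \<partial>\<pi>"
  have "?T \<le> (\<integral>\<^sup>+ (x, y). ennreal ((dist x y)\<^sup>2) \<partial>?\<pi>)"
    using plan by (rule INF_lower)
  also have "\<dots> \<le> ennreal (1 / m) * ennreal C"
    unfolding nn_integral_scale_measure[OF dm] using cost by (rule mult_left_mono) simp
  also have "\<dots> = ennreal (C / m)" using m C by (simp flip: ennreal_mult)
  finally have "enn2real ?T \<le> C / m"
    using m C by (intro enn2real_leI) auto
  then show ?thesis using m unfolding W2_squared m_def[symmetric] by (simp add: field_simps)
qed (simp add: W2_squared C)

text \<open>For any intermediate measures the pairing splits into two total variation terms and a
  transport term. The bound \<open>l * a\<close> on the potentials is exactly what turns the price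
  \<open>a\<close> per unit of variation, weighted by \<open>l\<close>, into an upper bound.\<close>

lemma gen_wasserstein_weak_duality:
  fixes \<phi> \<psi> :: "'a::polish_space \<Rightarrow> real"
  assumes pos: "0 < a" "0 < b" "0 < l"
    and M: "M \<in> finite_borel_measures" and N: "N \<in> finite_borel_measures"
    and \<phi>: "\<phi> \<in> borel_measurable borel" "\<And>x. \<bar>\<phi> x\<bar> \<le> l * a"
    and \<psi>: "\<psi> \<in> borel_measurable borel" "\<And>x. \<bar>\<psi> x\<bar> \<le> l * a"
    and le: "\<And>x y. \<phi> x + \<psi> y \<le> l * b\<^sup>2 * (dist x y)\<^sup>2"
  shows "integral\<^sup>L M \<phi> + integral\<^sup>L N \<psi> \<le> l * (gen_wasserstein a b M N)\<^sup>2"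
proof -
  have a: "0 \<le> a" using pos by simp
  have "(integral\<^sup>L M \<phi> + integral\<^sup>L N \<psi>) / l \<le> (gen_wasserstein a b M N)\<^sup>2"
    unfolding gen_wasserstein_squared(1)[OF a M N]
  proof (rule cInf_greatest[OF gen_wasserstein_squared(2)[OF a M N]], clarify)
    fix \<nu>1 \<nu>2 :: "'a measure"
    assume \<nu>: "\<nu>1 \<in> finite_borel_measures2" "\<nu>2 \<in> finite_borel_measures2"
      "measure \<nu>1 UNIV = measure \<nu>2 UNIV"
    then have fb: "\<nu>1 \<in> finite_borel_measures" "\<nu>2 \<in> finite_borel_measures"
      by (auto simp: finite_borel_measures2_def)
    have "integral\<^sup>L \<nu>1 \<phi> + integral\<^sup>L \<nu>2 \<psi> \<le> l * b\<^sup>2 * (W2 \<nu>1 \<nu>2)\<^sup>2"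
      using pos by (intro W2_weak_duality[OF \<nu> \<phi> \<psi>] le) simp
    moreover have "integral\<^sup>L M \<phi> - integral\<^sup>L \<nu>1 \<phi> \<le> l * a * signed_norm (\<lambda>A. measure M A - measure \<nu>1 A)"
      by (rule integral_diff_le_signed_norm[OF M fb(1) \<phi>])
    moreover have "integral\<^sup>L N \<psi> - integral\<^sup>L \<nu>2 \<psi> \<le> l * a * signed_norm (\<lambda>A. measure N A - measure \<nu>2 A)"
      by (rule integral_diff_le_signed_norm[OF N fb(2) \<psi>])
    ultimately have "integral\<^sup>L M \<phi> + integral\<^sup>L N \<psi> \<le> l * (a * signed_norm (\<lambda>A. measure M A - measure \<nu>1 A)
        + a * signed_norm (\<lambda>A. measure N A - measure \<nu>2 A) + b\<^sup>2 * (W2 \<nu>1 \<nu>2)\<^sup>2)"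
      by (simp add: distrib_left mult.assoc)
    then show "(integral\<^sup>L M \<phi> + integral\<^sup>L N \<psi>) / l \<le> a * signed_norm (\<lambda>A. measure M A - measure \<nu>1 A)
        + a * signed_norm (\<lambda>A. measure N A - measure \<nu>2 A) + b\<^sup>2 * (W2 \<nu>1 \<nu>2)\<^sup>2"
      using pos by (simp add: pos_divide_le_eq mult.commute)
  qed
  then show ?thesis using pos by (simp add: pos_divide_le_eq mult.commute)
qed

section \<open>Bounds and measurability of the transformed potentials; weak duality on the compact
  set\<close>

lemma S_op_bdd_below:
  fixes f :: "'a::metric_space \<Rightarrow> real"
  assumes "0 \<le> l" "\<And>y. y \<in> K \<Longrightarrow> f y \<le> u"
  shows "bdd_below ((\<lambda>y. l * b\<^sup>2 * (dist x y)\<^sup>2 - f y) ` K)"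
proof (rule bdd_belowI2[where m = "- u"])
  fix y assume "y \<in> K"
  moreover have "0 \<le> l * b\<^sup>2 * (dist x y)\<^sup>2" using assms(1) by simp
  ultimately show "- u \<le> l * b\<^sup>2 * (dist x y)\<^sup>2 - f y" using assms(2)[of y] by linarith
qed

text \<open>As an infimum of continuous functions of \<open>x\<close> it is upper semicontinuous:
  strict sublevel sets are unions of open sets over \<open>y\<close>, which copes with an
  uncountable \<open>K\<close>.\<close>

lemma S_op_measurable:
  fixes f :: "'a::metric_space \<Rightarrow> real"
  assumes "0 \<le> l" "\<And>y. y \<in> K \<Longrightarrow> f y \<le> u" "K \<noteq> {}"
  shows "S_op b K l f \<in> borel_measurable borel"
  unfolding borel_measurable_iff_less
proof
  fix t :: real
  have "{x \<in> space borel. S_op b K l f x < t} = (\<Union>y\<in>K. {x. l * b\<^sup>2 * (dist x y)\<^sup>2 - f y < t})"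
    using cINF_less_iff[OF assms(3) S_op_bdd_below[OF assms(1,2)]] by (auto simp: S_op_def)
  moreover have "open {x. l * b\<^sup>2 * (dist x y)\<^sup>2 - f y < t}" for y
    by (intro open_Collect_less continuous_intros)
  ultimately show "{x \<in> space borel. S_op b K l f x < t} \<in> sets borel"
    by (simp add: borel_open open_UN)
qed

text \<open>The cap on \<open>f\<close> and the nonnegative cost bound \<open>S_op\<close> from
  below by \<open>- (l * a)\<close>, and the \<open>min\<close> gives the upper bound. The last
  claim holds because \<open>y\<close> competes in the infimum. The point \<open>x\<close> ranges
  over the whole space.\<close>

lemma Sbar_op_props:
  fixes f :: "'a::metric_space \<Rightarrow> real"
  assumes l: "0 \<le> l" "0 \<le> a" and f: "\<And>y. y \<in> K \<Longrightarrow> f y \<le> l * a" and "K \<noteq> {}"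
  shows "Sbar_op a b K l f \<in> borel_measurable borel"
    and "\<bar>Sbar_op a b K l f x\<bar> \<le> l * a"
    and "y \<in> K \<Longrightarrow> Sbar_op a b K l f x + f y \<le> l * b\<^sup>2 * (dist x y)\<^sup>2"
proof -
  show "Sbar_op a b K l f \<in> borel_measurable borel"
    using S_op_measurable[OF l(1) f \<open>K \<noteq> {}\<close>, where b = b] unfolding Sbar_op_def by measurable
  have "- (l * a) \<le> S_op b K l f x"
    unfolding S_op_def
  proof (rule cINF_greatest[OF \<open>K \<noteq> {}\<close>])
    fix y assume "y \<in> K"
    moreover have "0 \<le> l * b\<^sup>2 * (dist x y)\<^sup>2" using l by simp
    ultimately show "- (l * a) \<le> l * b\<^sup>2 * (dist x y)\<^sup>2 - f y" using f[of y] by linarith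
  qed
  moreover have "0 \<le> l * a" using l by simp
  ultimately show "\<bar>Sbar_op a b K l f x\<bar> \<le> l * a" by (auto simp: Sbar_op_def)
  show "Sbar_op a b K l f x + f y \<le> l * b\<^sup>2 * (dist x y)\<^sup>2" if "y \<in> K"
  proof -
    have "bdd_below ((\<lambda>y. l * b\<^sup>2 * (dist x y)\<^sup>2 - f y) ` K)"
      by (rule S_op_bdd_below[OF l(1)]) (rule f)
    then have "S_op b K l f x \<le> l * b\<^sup>2 * (dist x y)\<^sup>2 - f y"
      unfolding S_op_def using that by (rule cINF_lower)
    then show ?thesis by (simp add: Sbar_op_def)
  qed
qed

text \<open>Potentials are known only on \<open>K\<close>; this trades \<open>h\<close> for a
  globally Borel function that agrees with it there.\<close>

lemma set_integral_eq_of_null_compl: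
  fixes g :: "'a::topological_space \<Rightarrow> real"
  assumes M: "M \<in> finite_borel_measures" and K: "K \<in> sets borel" and null: "emeasure M (- K) = 0"
    and g: "g \<in> borel_measurable borel" and eq: "\<And>x. x \<in> K \<Longrightarrow> g x = h x"
  shows "(LINT x:K|M. h x) = integral\<^sup>L M g"
proof -
  note fb = finite_borel_measuresD[OF M]
  have [measurable]: "g \<in> borel_measurable M" "K \<in> sets M"
    unfolding measurable_cong_sets[OF fb(1) refl] fb(1) using g K by auto
  have "(LINT x:K|M. h x) = (LINT x|M. indicator K x * g x)"
    unfolding set_lebesgue_integral_def using eq by (intro Bochner_Integration.integral_cong) (auto simp: indicator_def)
  also have "AE x in M. x \<in> K"
    using null K fb by (intro AE_I[of _ _ "- K"]) auto
  then have "(LINT x|M. indicator K x * g x) = integral\<^sup>L M g"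
    by (intro integral_cong_AE) auto
  finally show ?thesis .
qed

text \<open>Off \<open>K\<close> both potentials are set to \<open>- l * a\<close>. As the other potential is at most \<open>l * a\<close>, this
  preserves the constraint, and the potentials become bounded by \<open>l * a\<close> in absolute value, so that
  they can be tested against arbitrary intermediate measures.\<close>

lemma Sbar_op_weak_duality:
  fixes f :: "'a::polish_space \<Rightarrow> real"
  assumes pos: "0 < a" "0 < b" "0 < l" and K: "closed K"
    and M: "M \<in> finite_borel_measures" "emeasure M (- K) = 0"
    and N: "N \<in> finite_borel_measures" "emeasure N (- K) = 0"
    and f: "f \<in> F_set a K l"
  shows "(LINT x:K|M. Sbar_op a b K l f x) + (LINT x:K|N. f x) \<le> l * (gen_wasserstein a b M N)\<^sup>2"
proof (cases "K = {}")
  case True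
  then show ?thesis using pos by (simp add: set_lebesgue_integral_def)
next
  case False
  have cont: "continuous_on K f" and le: "\<And>x. x \<in> K \<Longrightarrow> f x \<le> l * a" and bd: "bounded (f ` K)"
    using f by (auto simp: F_set_def)
  obtain B where B: "\<And>x. x \<in> K \<Longrightarrow> \<bar>f x\<bar> \<le> B" using bd by (auto simp: bounded_iff)
  have Kb: "K \<in> sets borel" using K by auto
  note S = Sbar_op_props[where l = l and a = a and K = K and f = f and b = b, OF _ _ le False]
  have la: "0 \<le> l * a" using pos by simp
  define \<phi> where "\<phi> x = (if x \<in> K then Sbar_op a b K l f x else - (l * a))" for x
  define f0 where "f0 x = (if x \<in> K then f x else 0)" for x
  \<comment> \<open>On \<open>K\<close> itself \<open>f\<close> may drop below
    \<open>- (l * a)\<close>, so it is truncated there. Truncation can only raise the integral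
    against \<open>N\<close>; \<open>f0\<close> keeps the original values for that
    comparison.\<close>
  define \<psi> where "\<psi> x = (if x \<in> K then max (f0 x) (- (l * a)) else - (l * a))" for x
  have \<phi>: "\<phi> \<in> borel_measurable borel" "\<And>x. \<bar>\<phi> x\<bar> \<le> l * a"
  proof -
    have [measurable]: "Sbar_op a b K l f \<in> borel_measurable borel" using S pos by simp
    show "\<phi> \<in> borel_measurable borel" unfolding \<phi>_def using Kb by measurable
    show "\<bar>\<phi> x\<bar> \<le> l * a" for x using S(2) pos la by (simp add: \<phi>_def)
  qed
  have f0[measurable]: "f0 \<in> borel_measurable borel"
    unfolding f0_def using Kb cont by (intro borel_measurable_continuous_on_if) auto
  have \<psi>: "\<psi> \<in> borel_measurable borel" "\<And>x. \<bar>\<psi> x\<bar> \<le> l * a"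
  proof -
    show "\<psi> \<in> borel_measurable borel" unfolding \<psi>_def using Kb by measurable
    show "\<bar>\<psi> x\<bar> \<le> l * a" for x using le la by (auto simp: \<psi>_def f0_def abs_le_iff)
  qed
  have "\<phi> x + \<psi> y \<le> l * b\<^sup>2 * (dist x y)\<^sup>2" for x y
  proof -
    have "0 \<le> l * b\<^sup>2 * (dist x y)\<^sup>2" using pos by simp
    moreover have "\<phi> x \<le> l * a" "\<psi> y \<le> l * a" using \<phi>(2)[of x] \<psi>(2)[of y] by (auto simp: abs_le_iff)
    moreover have "Sbar_op a b K l f x + f y \<le> l * b\<^sup>2 * (dist x y)\<^sup>2" if "y \<in> K"
      using S(3) that pos by simp
    ultimately show ?thesis by (auto simp: \<phi>_def \<psi>_def f0_def max_def)
  qed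
  note dual = gen_wasserstein_weak_duality[OF pos M(1) N(1) \<phi> \<psi> this]
  have "(LINT x:K|M. Sbar_op a b K l f x) = integral\<^sup>L M \<phi>"
    by (rule set_integral_eq_of_null_compl[OF M(1) Kb M(2) \<phi>(1)]) (simp add: \<phi>_def)
  moreover have "(LINT x:K|N. f x) = integral\<^sup>L N f0"
    by (rule set_integral_eq_of_null_compl[OF N(1) Kb N(2) f0]) (simp add: f0_def)
  moreover have "integral\<^sup>L N f0 = (LINT x:K|N. f0 x)" "integral\<^sup>L N \<psi> = (LINT x:K|N. \<psi> x)"
    by (rule set_integral_eq_of_null_compl[OF N(1) Kb N(2), symmetric]; use \<psi> in simp)+
  moreover have "(LINT x:K|N. f0 x) \<le> (LINT x:K|N. \<psi> x)"
  proof (rule set_integral_mono)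
    have KN: "K \<in> sets N" using Kb finite_borel_measuresD[OF N(1)] by simp
    have "0 \<le> B" using B False by fastforce
    then have "integrable N f0" using B
      by (intro finite_borel_measures_integrable[OF N(1) f0, of B]) (auto simp: f0_def)
    then show "set_integrable N K f0" unfolding set_integrable_def
      using KN by (intro integrable_mult_indicator)
    show "set_integrable N K \<psi>" unfolding set_integrable_def
      using KN finite_borel_measures_integrable[OF N(1) \<psi>] by (intro integrable_mult_indicator)
  qed (auto simp: \<psi>_def)
  ultimately show ?thesis using dual by linarith
qed

section \<open>Quantization of a compact set and of transport plans\<close>

text \<open>A finite subcover by balls is made disjoint by precedence: in the induction the newly
  added ball overrides the previous map. Outside all balls \<open>q\<close> is the identity, so it
  is Borel on the whole space.\<close>

lemma compact_measurable_quantization: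
  fixes K :: "'a::metric_space set"
  assumes "compact K" "0 < \<epsilon>"
  obtains Y q where "finite Y" "Y \<subseteq> K" "q \<in> borel_measurable borel"
    "\<And>x. x \<in> K \<Longrightarrow> q x \<in> Y \<and> dist x (q x) < \<epsilon>"
proof -
  have "K \<subseteq> (\<Union>y\<in>K. ball y \<epsilon>)" using assms(2) by auto
  then obtain Y where Y: "Y \<subseteq> K" "finite Y" "K \<subseteq> (\<Union>y\<in>Y. ball y \<epsilon>)"
    by (rule compactE_image[OF assms(1) open_ball])
  have "\<exists>q \<in> borel_measurable borel. \<forall>x \<in> (\<Union>y\<in>Y. ball y \<epsilon>). q x \<in> Y \<and> dist x (q x) < \<epsilon>"
    using Y(2)
  proof (induction Y rule: finite_induct)
    case empty
    show ?case by (intro bexI[of _ "\<lambda>x. x"]) auto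
  next
    case (insert y Y)
    then obtain q where q[measurable]: "q \<in> borel_measurable borel"
      and qY: "\<And>x. x \<in> (\<Union>y\<in>Y. ball y \<epsilon>) \<Longrightarrow> q x \<in> Y \<and> dist x (q x) < \<epsilon>" by blast
    have [measurable]: "ball y \<epsilon> \<in> sets borel" by simp
    show ?case
    proof (intro bexI[of _ "\<lambda>x. if x \<in> ball y \<epsilon> then y else q x"] ballI)
      fix x assume x: "x \<in> (\<Union>y\<in>insert y Y. ball y \<epsilon>)"
      show "(if x \<in> ball y \<epsilon> then y else q x) \<in> insert y Y \<and> dist x (if x \<in> ball y \<epsilon> then y else q x) < \<epsilon>"
      proof (cases "x \<in> ball y \<epsilon>")
        case False
        then show ?thesis using qY[of x] x by simp
      qed (simp add: dist_commute)
    qed measurable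
  qed
  then obtain q where "q \<in> borel_measurable borel"
    "\<forall>x \<in> (\<Union>y\<in>Y. ball y \<epsilon>). q x \<in> Y \<and> dist x (q x) < \<epsilon>" by (elim bexE)
  then show thesis using Y by (intro that[of Y q]) auto
qed

text \<open>\<open>point_measure\<close> lives on the subsets of \<open>Y\<close>; its image under
  the identity is the same weighting as a Borel measure.\<close>

lemma discrete_finite_borel_measure:
  fixes n :: "'a::t1_space \<Rightarrow> real"
  assumes Y: "finite Y" and n: "\<And>z. z \<in> Y \<Longrightarrow> 0 \<le> n z"
  obtains N where "N \<in> finite_borel_measures"
    "\<And>A. A \<in> sets borel \<Longrightarrow> emeasure N A = ennreal (\<Sum>z\<in>Y. n z * indicator A z)"
proof -
  let ?N = "distr (point_measure Y (\<lambda>z. ennreal (n z))) borel (\<lambda>z. z)"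
  have em: "emeasure ?N A = ennreal (\<Sum>z\<in>Y. n z * indicator A z)" if A: "A \<in> sets borel" for A
  proof -
    have "emeasure ?N A = emeasure (point_measure Y (\<lambda>z. ennreal (n z))) (A \<inter> Y)"
      using A by (subst emeasure_distr) (auto simp: space_point_measure)
    also have "\<dots> = (\<Sum>z\<in>A \<inter> Y. ennreal (n z))"
      using Y by (intro emeasure_point_measure_finite) auto
    also have "\<dots> = ennreal (\<Sum>z\<in>A \<inter> Y. n z)" using n by (intro sum_ennreal) auto
    also have "(\<Sum>z\<in>A \<inter> Y. n z) = (\<Sum>z\<in>Y. n z * indicator A z)"
      using Y by (simp add: indicator_def if_distrib sum.If_cases Int_commute cong: if_cong)
    finally show ?thesis .
  qed
  have "?N \<in> finite_borel_measures"
    using em[of UNIV] by (auto simp: finite_borel_measures_def intro!: finite_measureI)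
  then show thesis by (rule that) (rule em)
qed

text \<open>In terms of the cells \<open>C y = {x \<in> K. q x = y}\<close>, the plan spreads the mass \<open>\<gamma> y z\<close> over \<open>C y \<times> {z}\<close>
  proportionally to \<open>M\<close>; a null cell gives \<open>\<gamma> y z / 0 = 0\<close>.\<close>

lemma gen_wasserstein_le_quantized:
  fixes M N :: "'a::polish_space measure" and a b :: real and n :: "'a \<Rightarrow> real"
    and \<gamma> c :: "'a \<Rightarrow> 'a \<Rightarrow> real" and q :: "'a \<Rightarrow> 'a"
  assumes "0 \<le> a" and K: "compact K" and M: "M \<in> finite_borel_measures" and N: "N \<in> finite_borel_measures"
    and Y: "finite Y" "Y \<subseteq> K" and q: "q \<in> borel_measurable borel" "\<And>x. x \<in> K \<Longrightarrow> q x \<in> Y"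
    and NY: "\<And>A. A \<in> sets borel \<Longrightarrow> emeasure N A = ennreal (\<Sum>z\<in>Y. n z * indicator A z)"
    and \<gamma>: "\<And>y z. y \<in> Y \<Longrightarrow> z \<in> Y \<Longrightarrow> 0 \<le> \<gamma> y z"
    and \<gamma>M: "\<And>y. y \<in> Y \<Longrightarrow> (\<Sum>z\<in>Y. \<gamma> y z) \<le> measure M {x \<in> K. q x = y}"
    and \<gamma>N: "\<And>z. z \<in> Y \<Longrightarrow> (\<Sum>y\<in>Y. \<gamma> y z) \<le> n z"
    and c: "\<And>x z. x \<in> K \<Longrightarrow> z \<in> Y \<Longrightarrow> (dist x z)\<^sup>2 \<le> c (q x) z"
  shows "(gen_wasserstein a b M N)\<^sup>2 \<le> a * (measure M UNIV - (\<Sum>y\<in>Y. \<Sum>z\<in>Y. \<gamma> y z))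
     + a * ((\<Sum>z\<in>Y. n z) - (\<Sum>y\<in>Y. \<Sum>z\<in>Y. \<gamma> y z)) + b\<^sup>2 * (\<Sum>y\<in>Y. \<Sum>z\<in>Y. c y z * \<gamma> y z)"
proof -
  note fM = finite_borel_measuresD[OF M] and fN = finite_borel_measuresD[OF N]
  interpret M: finite_measure M by (rule fM)
  interpret Yc: sigma_finite_measure "count_space Y"
    using Y by (intro sigma_finite_measure_count_space_finite)
  define C where "C y = {x \<in> K. q x = y}" for y
  have Kb: "K \<in> sets borel" using compact_imp_closed[OF K] by (rule borel_closed)
  have Cb: "C y \<in> sets borel" for y
  proof -
    have "C y = K \<inter> q -` {y}" by (auto simp: C_def)
    then show ?thesis using Kb measurable_sets_borel[OF q(1), of "{y}"] by auto
  qed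
  have CM[measurable]: "C y \<in> sets M" for y using Cb fM by simp
  define m where "m y = measure M (C y)" for y
  \<comment> \<open>On a null cell \<open>\<gamma>M\<close> forces \<open>\<gamma> y z = 0\<close>,
    so the convention for division by zero loses no mass.\<close>
  have m: "\<gamma> y z / m y * m y = \<gamma> y z" if "y \<in> Y" "z \<in> Y" for y z
  proof (cases "m y = 0")
    case True
    have "\<gamma> y z \<le> (\<Sum>z\<in>Y. \<gamma> y z)" using that Y \<gamma> by (intro member_le_sum) auto
    also have "\<dots> \<le> 0" using \<gamma>M[OF that(1)] True by (simp add: m_def C_def)
    finally show ?thesis using \<gamma>[OF that] by simp
  qed simp
  \<comment> \<open>\<open>h x z\<close> is the fraction of the mass at \<open>x\<close> that is
    sent to \<open>z\<close>, that is, the density of the plan with respect to the product of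
    \<open>M\<close> and counting measure on \<open>Y\<close>.\<close>
  define h where "h x z = (\<Sum>y\<in>Y. indicator (C y) x * (\<gamma> y z / m y))" for x z
  have h_nn: "0 \<le> h x z" if "z \<in> Y" for x z
    unfolding h_def using \<gamma> that by (intro sum_nonneg) (auto simp: m_def)
  have h_K: "h x z = \<gamma> (q x) z / m (q x)" if "x \<in> K" for x z
  proof -
    have "h x z = (\<Sum>y\<in>Y. if y = q x then \<gamma> y z / m y else 0)"
      unfolding h_def using that by (intro sum.cong) (auto simp: C_def)
    then show ?thesis using Y q(2)[OF that] by simp
  qed
  have h_off: "h x z = 0" if "x \<notin> K" for x z
    unfolding h_def using that by (intro sum.neutral) (auto simp: C_def)
  define P where "P = M \<Otimes>\<^sub>M count_space Y"
  have hm[measurable]: "(\<lambda>x. h x z) \<in> borel_measurable M" for z unfolding h_def by measurable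
  have fst_P: "fst \<in> measurable P M" and snd_P: "snd \<in> measurable P (count_space Y)"
    by (simp_all add: P_def)
  have hP: "(\<lambda>w. ennreal (h (fst w) (snd w))) \<in> borel_measurable P"
    using measurable_compose[OF fst_P hm] Y
    by (intro measurable_compose_countable'[OF _ snd_P, where f = "\<lambda>z w. ennreal (h (fst w) z)"]
        measurable_compose[OF _ measurable_ennreal] countable_finite)
  \<comment> \<open>As a map \<open>T\<close> is the identity. It only changes the sigma-algebra,
    since the second factor of \<open>P\<close> has \<open>Y\<close> as its space.\<close>
  define T where "T w = (fst w, snd w)" for w :: "'a \<times> 'a"
  have Tm: "T \<in> measurable P borel"
    unfolding T_def[abs_def] borel_prod[symmetric]
    using measurable_compose[OF fst_P measurable_ident_sets[OF fM(1)]] measurable_compose[OF snd_P, of "\<lambda>z. z" borel]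
    by (intro measurable_Pair) simp_all
  define G where "G = distr (density P (\<lambda>w. ennreal (h (fst w) (snd w)))) borel T"
  have sG: "sets G = sets borel" "space G = UNIV" by (simp_all add: G_def)
  have nnG: "nn_integral G F = (\<integral>\<^sup>+ x. (\<Sum>z\<in>Y. ennreal (h x z) * F (x, z)) \<partial>M)"
    if F[measurable]: "F \<in> borel_measurable borel" for F
  proof -
    have FT: "(\<lambda>w. F (T w)) \<in> borel_measurable P" using measurable_compose[OF Tm F] .
    have "nn_integral G F = (\<integral>\<^sup>+ w. ennreal (h (fst w) (snd w)) * F (T w) \<partial>P)"
      unfolding G_def using Tm hP FT
      by (subst nn_integral_distr) (auto simp: nn_integral_density)
    also have "\<dots> = (\<integral>\<^sup>+ x. (\<integral>\<^sup>+ z. ennreal (h (fst (x, z)) (snd (x, z))) * F (T (x, z)) \<partial>count_space Y) \<partial>M)"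
      unfolding P_def using hP FT
      by (intro Yc.nn_integral_fst[symmetric]) (simp flip: P_def)
    also have "\<dots> = (\<integral>\<^sup>+ x. (\<Sum>z\<in>Y. ennreal (h x z) * F (x, z)) \<partial>M)"
      using Y by (simp add: nn_integral_count_space_finite T_def)
    finally show ?thesis .
  qed
  \<comment> \<open>A function of the cell and the target alone integrates exactly to a finite sum.
    With pointwise domination this becomes \<open>upper\<close>, which controls the second marginal,
    the second moments and the transport cost.\<close>
  have cell: "(\<integral>\<^sup>+ x. (\<Sum>z\<in>Y. ennreal (h x z) * ennreal (d (q x) z)) \<partial>M)
      = ennreal (\<Sum>y\<in>Y. \<Sum>z\<in>Y. d y z * \<gamma> y z)"
    if d: "\<And>y z. y \<in> Y \<Longrightarrow> z \<in> Y \<Longrightarrow> 0 \<le> d y z" for d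
  proof -
    have "(\<Sum>z\<in>Y. ennreal (h x z) * ennreal (d (q x) z))
        = (\<Sum>y\<in>Y. \<Sum>z\<in>Y. ennreal (d y z * (\<gamma> y z / m y)) * indicator (C y) x)" for x
    proof (cases "x \<in> K")
      case True
      have "(\<Sum>y\<in>Y. \<Sum>z\<in>Y. ennreal (d y z * (\<gamma> y z / m y)) * indicator (C y) x)
          = (\<Sum>y\<in>Y. if y = q x then \<Sum>z\<in>Y. ennreal (d y z * (\<gamma> y z / m y)) else 0)"
        using True by (intro sum.cong) (auto simp: C_def)
      also have "\<dots> = (\<Sum>z\<in>Y. ennreal (d (q x) z * (\<gamma> (q x) z / m (q x))))"
        using Y q(2)[OF True] by simp
      also have "\<dots> = (\<Sum>z\<in>Y. ennreal (h x z) * ennreal (d (q x) z))"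
        using True q(2)[OF True] d h_nn[of _ x]
        by (intro sum.cong) (auto simp: h_K mult.commute simp flip: ennreal_mult'')
      finally show ?thesis ..
    next
      case False
      then show ?thesis by (simp add: h_off C_def)
    qed
    then have "(\<integral>\<^sup>+ x. (\<Sum>z\<in>Y. ennreal (h x z) * ennreal (d (q x) z)) \<partial>M)
        = (\<Sum>y\<in>Y. \<Sum>z\<in>Y. ennreal (d y z * (\<gamma> y z / m y)) * emeasure M (C y))"
      by (simp add: nn_integral_sum nn_integral_cmult_indicator)
    also have "\<dots> = (\<Sum>y\<in>Y. \<Sum>z\<in>Y. ennreal (d y z * \<gamma> y z))"
    proof (intro sum.cong refl)
      fix y z assume yz: "y \<in> Y" "z \<in> Y"
      have "ennreal (d y z * (\<gamma> y z / m y)) * emeasure M (C y) = ennreal (d y z * (\<gamma> y z / m y) * m y)"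
        unfolding M.emeasure_eq_measure m_def by (rule ennreal_mult''[symmetric]) (rule measure_nonneg)
      also have "d y z * (\<gamma> y z / m y) * m y = d y z * \<gamma> y z"
        using m[OF yz] by (metis mult.assoc)
      finally show "ennreal (d y z * (\<gamma> y z / m y)) * emeasure M (C y) = ennreal (d y z * \<gamma> y z)" .
    qed
    also have "\<dots> = ennreal (\<Sum>y\<in>Y. \<Sum>z\<in>Y. d y z * \<gamma> y z)"
      using d \<gamma> by (simp add: sum_nonneg cong: sum.cong)
    finally show ?thesis .
  qed
  have upper: "nn_integral G F \<le> ennreal (\<Sum>y\<in>Y. \<Sum>z\<in>Y. d y z * \<gamma> y z)"
    if F: "F \<in> borel_measurable borel" and d: "\<And>y z. y \<in> Y \<Longrightarrow> z \<in> Y \<Longrightarrow> 0 \<le> d y z"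
      and le: "\<And>x z. x \<in> K \<Longrightarrow> z \<in> Y \<Longrightarrow> F (x, z) \<le> ennreal (d (q x) z)" for F d
  proof -
    have "nn_integral G F \<le> (\<integral>\<^sup>+ x. (\<Sum>z\<in>Y. ennreal (h x z) * ennreal (d (q x) z)) \<partial>M)"
      unfolding nnG[OF F]
    proof (intro nn_integral_mono sum_mono)
      fix x z assume "z \<in> Y"
      then show "ennreal (h x z) * F (x, z) \<le> ennreal (h x z) * ennreal (d (q x) z)"
        using le[of x z] by (cases "x \<in> K") (auto simp: h_off intro: mult_left_mono)
    qed
    also have "\<dots> = ennreal (\<Sum>y\<in>Y. \<Sum>z\<in>Y. d y z * \<gamma> y z)" by (rule cell) (rule d)
    finally show ?thesis .
  qed
  define g where "g = (\<Sum>y\<in>Y. \<Sum>z\<in>Y. \<gamma> y z)"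
  have g: "0 \<le> g" unfolding g_def using \<gamma> by (intro sum_nonneg) auto
  have GU: "emeasure G UNIV = ennreal g"
    using nnG[of "\<lambda>_. 1"] cell[of "\<lambda>_ _. 1"] sG by (simp add: g_def)
  interpret G: finite_measure G using GU sG by (intro finite_measureI) simp
  have fstm: "fst \<in> measurable G (borel :: 'a measure)" and sndm: "snd \<in> measurable G (borel :: 'a measure)"
    unfolding measurable_cong_sets[OF sG(1) refl]
    by (auto intro!: borel_measurable_continuous_onI continuous_intros)
  define \<nu>1 where "\<nu>1 = distr G borel fst"
  define \<nu>2 where "\<nu>2 = distr G borel snd"
  have fb: "\<nu>1 \<in> finite_borel_measures" "\<nu>2 \<in> finite_borel_measures"
    using G.finite_measure_distr[OF fstm] G.finite_measure_distr[OF sndm]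
    by (auto simp: finite_borel_measures_def \<nu>1_def \<nu>2_def)
  have \<nu>: "measure \<nu>1 A = measure G (A \<times> UNIV)" "measure \<nu>2 A = measure G (UNIV \<times> A)"
    if "A \<in> sets borel" for A
    using that measure_distr[OF fstm] measure_distr[OF sndm] sG
    by (auto simp: \<nu>1_def \<nu>2_def fst_vimage_eq_Times snd_vimage_eq_Times)
  have mass: "measure \<nu>1 UNIV = g" "measure \<nu>2 UNIV = g"
  proof -
    have "measure G UNIV = g" using GU g by (simp add: measure_def)
    then show "measure \<nu>1 UNIV = g" "measure \<nu>2 UNIV = g" using \<nu>[of UNIV] by simp_all
  qed
  have ind: "(\<lambda>w. indicator (A \<times> UNIV) w) \<in> borel_measurable (borel :: ('a \<times> 'a) measure)"
      "(\<lambda>w. indicator (UNIV \<times> A) w) \<in> borel_measurable (borel :: ('a \<times> 'a) measure)"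
      "A \<times> UNIV \<in> sets (borel :: ('a \<times> 'a) measure)" "UNIV \<times> A \<in> sets (borel :: ('a \<times> 'a) measure)"
    if "A \<in> sets borel" for A :: "'a set"
    using borel_Times[OF that, of "UNIV :: 'a set"] borel_Times[of "UNIV :: 'a set", OF _ that]
    by simp_all
  \<comment> \<open>By \<open>\<gamma>M\<close> the weights \<open>h x z\<close> of a fixed
    \<open>x\<close> sum to at most 1, so the first marginal is below \<open>M\<close> on every
    Borel set and not merely on cells. Domination is what makes the variation term a difference of
    masses.\<close>
  have le1: "measure \<nu>1 A \<le> measure M A" if A: "A \<in> sets borel" for A
  proof -
    have "emeasure G (A \<times> UNIV) = (\<integral>\<^sup>+ x. (\<Sum>z\<in>Y. ennreal (h x z) * indicator (A \<times> UNIV) (x, z)) \<partial>M)"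
      using nnG[OF ind(1)[OF A]] ind(3)[OF A] sG by simp
    also have "\<dots> \<le> (\<integral>\<^sup>+ x. indicator A x \<partial>M)"
    proof (rule nn_integral_mono)
      fix x
      have "(\<Sum>z\<in>Y. h x z) \<le> 1"
      proof (cases "x \<in> K")
        case True
        then have "(\<Sum>z\<in>Y. h x z) = (\<Sum>z\<in>Y. \<gamma> (q x) z) / m (q x)"
          by (simp add: h_K sum_divide_distrib)
        also have "\<dots> \<le> 1"
          using \<gamma>M[OF q(2)[OF True]] measure_nonneg[of M "C (q x)"]
          by (auto simp: m_def C_def divide_le_eq_1 zero_less_measure_iff)
        finally show ?thesis .
      qed (simp add: h_off)
      then have "(\<Sum>z\<in>Y. ennreal (h x z)) \<le> 1"
        using h_nn by (simp add: sum_ennreal)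
      then show "(\<Sum>z\<in>Y. ennreal (h x z) * indicator (A \<times> UNIV) (x, z)) \<le> indicator A x"
        by (auto simp: indicator_def)
    qed
    also have "\<dots> = emeasure M A" using A fM by simp
    finally show ?thesis
      using \<nu>(1)[OF A] by (simp add: G.emeasure_eq_measure M.emeasure_eq_measure)
  qed
  have le2: "measure \<nu>2 A \<le> measure N A" if A: "A \<in> sets borel" for A
  proof -
    have "emeasure G (UNIV \<times> A) = nn_integral G (indicator (UNIV \<times> A))"
      using ind(4)[OF A] sG by (simp add: nn_integral_indicator)
    also have "\<dots> \<le> ennreal (\<Sum>y\<in>Y. \<Sum>z\<in>Y. indicator A z * \<gamma> y z)"
      by (rule upper[OF ind(2)[OF A]]) (auto simp: indicator_def)
    also have "(\<Sum>y\<in>Y. \<Sum>z\<in>Y. indicator A z * \<gamma> y z) = (\<Sum>z\<in>Y. (\<Sum>y\<in>Y. \<gamma> y z) * indicator A z)"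
      by (subst sum.swap) (simp add: mult.commute flip: sum_distrib_left)
    also have "ennreal \<dots> \<le> ennreal (\<Sum>z\<in>Y. n z * indicator A z)"
      using \<gamma>N by (intro ennreal_leI sum_mono mult_right_mono) auto
    also have "\<dots> = emeasure N A" using NY[OF A] by simp
    finally show ?thesis
      using \<nu>(2)[OF A] by (simp add: G.emeasure_eq_measure finite_measure.emeasure_eq_measure[OF fN(3)])
  qed
  obtain x0 r where r: "\<And>x. x \<in> K \<Longrightarrow> dist x x0 \<le> r"
    using compact_imp_bounded[OF K] by (auto simp: bounded_def dist_commute)
  have r2: "ennreal ((dist x x0)\<^sup>2) \<le> ennreal (r\<^sup>2)" if "x \<in> K" for x
    using r[OF that] by (intro ennreal_leI power_mono) auto
  have dm: "(\<lambda>x. ennreal ((dist x x0)\<^sup>2)) \<in> borel_measurable (borel :: 'a measure)"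
    by (intro measurable_compose[OF _ measurable_ennreal] borel_measurable_continuous_onI continuous_intros)
  have dm': "(\<lambda>x. ennreal ((dist x x0)\<^sup>2)) \<in> borel_measurable (distr G borel H)" for H :: "'a \<times> 'a \<Rightarrow> 'a"
    using dm by simp
  have "(\<integral>\<^sup>+ x. ennreal ((dist x x0)\<^sup>2) \<partial>\<nu>1) < \<infinity>" "(\<integral>\<^sup>+ x. ennreal ((dist x x0)\<^sup>2) \<partial>\<nu>2) < \<infinity>"
  proof -
    have 1: "(\<lambda>w. ennreal ((dist (fst w) x0)\<^sup>2)) \<in> borel_measurable (borel :: ('a \<times> 'a) measure)"
      "(\<lambda>w. ennreal ((dist (snd w) x0)\<^sup>2)) \<in> borel_measurable (borel :: ('a \<times> 'a) measure)"
      by (intro measurable_compose[OF _ measurable_ennreal] borel_measurable_continuous_onI continuous_intros)+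
    show "(\<integral>\<^sup>+ x. ennreal ((dist x x0)\<^sup>2) \<partial>\<nu>1) < \<infinity>"
      unfolding \<nu>1_def nn_integral_distr[OF fstm dm']
      by (rule le_less_trans[OF upper[OF 1(1), of "\<lambda>_ _. r\<^sup>2"]]) (use r2 in auto)
    show "(\<integral>\<^sup>+ x. ennreal ((dist x x0)\<^sup>2) \<partial>\<nu>2) < \<infinity>"
      unfolding \<nu>2_def nn_integral_distr[OF sndm dm']
      by (rule le_less_trans[OF upper[OF 1(2), of "\<lambda>_ _. r\<^sup>2"]]) (use r2 Y in auto)
  qed
  then have fb2: "\<nu>1 \<in> finite_borel_measures2" "\<nu>2 \<in> finite_borel_measures2"
    using fb by (auto simp: finite_borel_measures2_def)
  have N: "measure N UNIV = (\<Sum>z\<in>Y. n z)"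
  proof -
    have "0 \<le> n z" if "z \<in> Y" for z
      using \<gamma>N[OF that] \<gamma> that by (meson order_trans sum_nonneg)
    then show ?thesis using NY[of UNIV] by (simp add: measure_def sum_nonneg)
  qed
  \<comment> \<open>If the cell of \<open>y\<close> is empty, the hypothesis on \<open>c\<close>
    says nothing and \<open>c y z\<close> may be negative. There \<open>\<gamma> y z\<close>
    vanishes, so the truncation changes no term of the sum.\<close>
  define c' where "c' y z = max 0 (c y z)" for y z
  have c_eq: "c y z * \<gamma> y z = c' y z * \<gamma> y z" if "y \<in> Y" "z \<in> Y" for y z
  proof (cases "C y = {}")
    case True
    then have "\<gamma> y z = 0" using m[OF that] by (simp add: m_def)
    then show ?thesis by simp
  next
    case False
    then obtain x where "x \<in> K" "q x = y" by (auto simp: C_def)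
    then have "0 \<le> c y z" using c[of x z] that by (metis order_trans zero_le_power2)
    then show ?thesis by (simp add: c'_def)
  qed
  have "(W2 \<nu>1 \<nu>2)\<^sup>2 \<le> (\<Sum>y\<in>Y. \<Sum>z\<in>Y. c' y z * \<gamma> y z)"
  proof (rule W2_le_of_plan[OF sG(1) G.finite_measure_axioms])
    show "(\<integral>\<^sup>+ (x, y). ennreal ((dist x y)\<^sup>2) \<partial>G) \<le> ennreal (\<Sum>y\<in>Y. \<Sum>z\<in>Y. c' y z * \<gamma> y z)"
    proof (rule upper)
      show "(\<lambda>(x, y). ennreal ((dist x y)\<^sup>2)) \<in> borel_measurable (borel :: ('a \<times> 'a) measure)"
        unfolding case_prod_beta
        by (intro measurable_compose[OF _ measurable_ennreal] borel_measurable_continuous_onI continuous_intros)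
    qed (use c in \<open>auto simp: c'_def intro!: ennreal_leI max.coboundedI2\<close>)
    show "0 \<le> (\<Sum>y\<in>Y. \<Sum>z\<in>Y. c' y z * \<gamma> y z)"
      using \<gamma> by (intro sum_nonneg mult_nonneg_nonneg) (auto simp: c'_def)
  qed (simp_all add: \<nu>)
  also have "\<dots> = (\<Sum>y\<in>Y. \<Sum>z\<in>Y. c y z * \<gamma> y z)" by (intro sum.cong refl c_eq[symmetric])
  finally have W: "b\<^sup>2 * (W2 \<nu>1 \<nu>2)\<^sup>2 \<le> b\<^sup>2 * (\<Sum>y\<in>Y. \<Sum>z\<in>Y. c y z * \<gamma> y z)"
    by (rule mult_left_mono) simp
  have "signed_norm (\<lambda>A. measure M A - measure \<nu>1 A) = measure M UNIV - g"
    using signed_norm_diff_dominated[OF M fb(1)] le1 by (simp add: mass)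
  moreover have "signed_norm (\<lambda>A. measure N A - measure \<nu>2 A) = (\<Sum>z\<in>Y. n z) - g"
    using signed_norm_diff_dominated[OF \<open>N \<in> finite_borel_measures\<close> fb(2)] le2 by (simp add: mass N)
  ultimately show ?thesis
    using gen_wasserstein_squared_le[OF \<open>0 \<le> a\<close> M \<open>N \<in> finite_borel_measures\<close> fb2, of b] W
    by (simp add: mass g_def)
qed

section \<open>Interpolation of discrete potentials\<close>

text \<open>Uniform continuity of the squared distance near bounded pairs; only the base points lie
  in \<open>K\<close>, and the perturbed points may leave it.\<close>

lemma compact_dist_square_near:
  fixes K :: "'a::metric_space set"
  assumes "compact K" "0 < \<eta>"
  obtains \<epsilon> where "0 < \<epsilon>"
    "\<And>x y x' y'. x \<in> K \<Longrightarrow> y \<in> K \<Longrightarrow> dist x x' < \<epsilon> \<Longrightarrow> dist y y' < \<epsilon> \<Longrightarrow> (dist x' y')\<^sup>2 \<le> (dist x y)\<^sup>2 + \<eta>"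
proof -
  obtain D where D: "\<And>x y. x \<in> K \<Longrightarrow> y \<in> K \<Longrightarrow> dist x y \<le> D"
    using compact_imp_bounded[OF assms(1)] bounded_two_points[of K] by blast
  define R where "R = max D 0"
  \<comment> \<open>If a distance \<open>d \<le> R\<close> grows by \<open>2 * \<epsilon>\<close>,
    its square grows by \<open>4 * \<epsilon> * (d + \<epsilon>)\<close>, which for
    \<open>\<epsilon> \<le> 1\<close> is at most \<open>4 * \<epsilon> * (R + 1)\<close>.\<close>
  define \<epsilon> where "\<epsilon> = min 1 (\<eta> / (4 * (R + 1)))"
  have R: "0 \<le> R" by (simp add: R_def)
  then have pos: "0 < 4 * (R + 1)" by simp
  then have \<epsilon>: "0 < \<epsilon>" "\<epsilon> \<le> 1" using assms(2) by (simp_all add: \<epsilon>_def)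
  have "\<epsilon> \<le> \<eta> / (4 * (R + 1))" by (simp add: \<epsilon>_def)
  then have \<epsilon>3: "4 * \<epsilon> * (R + 1) \<le> \<eta>" using pos by (simp add: pos_le_divide_eq mult_ac)
  show thesis
  proof (rule that[OF \<epsilon>(1)])
    fix x y x' y' assume K: "x \<in> K" "y \<in> K" and d: "dist x x' < \<epsilon>" "dist y y' < \<epsilon>"
    have xy: "dist x y \<le> R" using D[OF K] by (simp add: R_def)
    have "dist x' y' \<le> dist x y + 2 * \<epsilon>"
      using d dist_triangle[of x' y' x] dist_triangle[of x y' y] by (simp add: dist_commute)
    then have "(dist x' y')\<^sup>2 \<le> (dist x y + 2 * \<epsilon>)\<^sup>2" by (intro power_mono) auto
    also have "\<dots> = (dist x y)\<^sup>2 + 4 * \<epsilon> * (dist x y + \<epsilon>)"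
      by (simp add: power2_eq_square algebra_simps)
    also have "4 * \<epsilon> * (dist x y + \<epsilon>) \<le> 4 * \<epsilon> * (R + 1)"
      using xy \<epsilon> by (intro mult_left_mono) auto
    finally show "(dist x' y')\<^sup>2 \<le> (dist x y)\<^sup>2 + \<eta>" using \<epsilon>3 by linarith
  qed
qed

text \<open>Tent functions of radius \<open>\<epsilon>\<close> around the net points are divided by
  their sum, which the net property keeps positive on \<open>K\<close>.\<close>

lemma net_partition_of_unity:
  fixes K :: "'a::metric_space set"
  assumes Y: "finite Y" and net: "\<And>x. x \<in> K \<Longrightarrow> \<exists>z\<in>Y. dist x z < \<epsilon>"
  obtains \<rho> :: "'a \<Rightarrow> 'a \<Rightarrow> real" where "\<And>z. continuous_on K (\<rho> z)"
    "\<And>x z. x \<in> K \<Longrightarrow> z \<in> Y \<Longrightarrow> 0 \<le> \<rho> z x"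
    "\<And>x. x \<in> K \<Longrightarrow> (\<Sum>z\<in>Y. \<rho> z x) = 1"
    "\<And>x z. x \<in> K \<Longrightarrow> z \<in> Y \<Longrightarrow> \<rho> z x \<noteq> 0 \<Longrightarrow> dist x z < \<epsilon>"
proof -
  define t where "t z x = max 0 (\<epsilon> - dist x z)" for z x :: 'a
  define w where "w x = (\<Sum>z\<in>Y. t z x)" for x
  have w: "0 < w x" if x: "x \<in> K" for x
  proof -
    obtain z where "z \<in> Y" "dist x z < \<epsilon>" using net[OF x] by blast
    then show ?thesis unfolding w_def
      by (intro sum_pos2[OF Y, of z]) (auto simp: t_def)
  qed
  have ct: "continuous_on K (t z)" for z
    unfolding t_def by (intro continuous_intros)
  then have cw: "continuous_on K w" unfolding w_def by (intro continuous_on_sum)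
  show thesis
  proof (rule that[of "\<lambda>z x. t z x / w x"])
    show "continuous_on K (\<lambda>x. t z x / w x)" for z
      using w by (intro continuous_on_divide ct cw) (metis less_irrefl)
    show "0 \<le> t z x / w x" if "x \<in> K" for x z using w[OF that] by (simp add: t_def)
    show "(\<Sum>z\<in>Y. t z x / w x) = 1" if "x \<in> K" for x
      using w[OF that] by (simp add: w_def flip: sum_divide_distrib)
    show "dist x z < \<epsilon>" if "t z x / w x \<noteq> 0" for x z
      using that by (auto simp: t_def max_def split: if_splits)
  qed
qed

text \<open>The bound is asked only where the weight is nonzero: an interpolated value involves only
  nearby net points, and the distance estimate holds only for those.\<close>

lemma convex_combination_le:
  fixes w g :: "'a \<Rightarrow> real"
  assumes "\<And>z. z \<in> Y \<Longrightarrow> 0 \<le> w z" "(\<Sum>z\<in>Y. w z) = 1"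
    and "\<And>z. z \<in> Y \<Longrightarrow> w z \<noteq> 0 \<Longrightarrow> g z \<le> B"
  shows "(\<Sum>z\<in>Y. w z * g z) \<le> B"
proof -
  have "(\<Sum>z\<in>Y. w z * g z) \<le> (\<Sum>z\<in>Y. w z * B)"
    using assms(1,3) by (intro sum_mono) (metis mult_left_mono mult_zero_left order_refl)
  also have "\<dots> = B" using assms(2) by (simp flip: sum_distrib_right)
  finally show ?thesis .
qed

text \<open>If \<open>\<rho> z y\<close> is nonzero, the squared distance from \<open>q x\<close> to
  \<open>z\<close> exceeds that from \<open>x\<close> to \<open>y\<close> by at most
  \<open>\<eta>\<close>. So the discrete constraint at \<open>(q x, z)\<close> bounds every
  \<open>f z\<close> entering the average \<open>g y\<close>, at a loss of
  \<open>l * b\<^sup>2 * \<eta>\<close> that does not depend on \<open>y\<close>. Caps survive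
  averaging, and integration multiplies the loss by the mass of \<open>M\<close>.\<close>

lemma Sbar_op_interpolation:
  fixes M :: "'a::polish_space measure" and a b l \<eta> \<epsilon> :: real and \<phi> f :: "'a \<Rightarrow> real"
    and \<rho> :: "'a \<Rightarrow> 'a \<Rightarrow> real" and q :: "'a \<Rightarrow> 'a"
  assumes pos: "0 < a" "0 < b" "0 < l" and K: "compact K"
    and M: "M \<in> finite_borel_measures" "emeasure M (- K) = 0"
    and Y: "finite Y" "Y \<subseteq> K"
    and q: "q \<in> borel_measurable borel" "\<And>x. x \<in> K \<Longrightarrow> q x \<in> Y \<and> dist x (q x) < \<epsilon>"
    and near: "\<And>x y x' y'. x \<in> K \<Longrightarrow> y \<in> K \<Longrightarrow> dist x x' < \<epsilon> \<Longrightarrow> dist y y' < \<epsilon>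
        \<Longrightarrow> (dist x' y')\<^sup>2 \<le> (dist x y)\<^sup>2 + \<eta>" and "0 < \<eta>"
    and \<rho>: "\<And>z. continuous_on K (\<rho> z)" "\<And>x z. x \<in> K \<Longrightarrow> z \<in> Y \<Longrightarrow> 0 \<le> \<rho> z x"
      "\<And>x. x \<in> K \<Longrightarrow> (\<Sum>z\<in>Y. \<rho> z x) = 1"
      "\<And>x z. x \<in> K \<Longrightarrow> z \<in> Y \<Longrightarrow> \<rho> z x \<noteq> 0 \<Longrightarrow> dist x z < \<epsilon>"
    and \<phi>f: "\<And>y z. y \<in> Y \<Longrightarrow> z \<in> Y \<Longrightarrow> \<phi> y + f z \<le> l * b\<^sup>2 * (dist y z)\<^sup>2"
    and \<phi>: "\<And>y. y \<in> Y \<Longrightarrow> \<phi> y \<le> l * a" and f: "\<And>z. z \<in> Y \<Longrightarrow> f z \<le> l * a"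
  defines "g \<equiv> \<lambda>x. \<Sum>z\<in>Y. \<rho> z x * f z"
  shows "g \<in> F_set a K l"
    and "(\<Sum>y\<in>Y. measure M {x \<in> K. q x = y} * \<phi> y) - l * b\<^sup>2 * \<eta> * measure M UNIV
         \<le> (LINT x:K|M. Sbar_op a b K l g x)"
proof -
  have cg: "continuous_on K g" unfolding g_def by (intro continuous_intros \<rho>(1))
  have g_le: "g x \<le> l * a" if "x \<in> K" for x
    unfolding g_def using that \<rho> f by (intro convex_combination_le) auto
  show gF: "g \<in> F_set a K l"
    using cg g_le compact_imp_bounded[OF compact_continuous_image[OF cg K]] by (simp add: F_set_def)
  note fM = finite_borel_measuresD[OF M(1)]
  interpret M: finite_measure M by (rule fM)
  have Kb: "K \<in> sets borel" using compact_imp_closed[OF K] by (rule borel_closed)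
  define \<delta> where "\<delta> = l * b\<^sup>2 * \<eta>"
  have \<delta>: "0 \<le> \<delta>" using pos \<open>0 < \<eta>\<close> by (simp add: \<delta>_def)
  have pw: "\<phi> (q x) - \<delta> \<le> Sbar_op a b K l g x" if x: "x \<in> K" for x
  proof -
    have "\<phi> (q x) - \<delta> \<le> S_op b K l g x"
      unfolding S_op_def
    proof (rule cINF_greatest)
      show "K \<noteq> {}" using x by auto
      fix y assume y: "y \<in> K"
      have "g y \<le> l * b\<^sup>2 * (dist x y)\<^sup>2 + \<delta> - \<phi> (q x)"
        unfolding g_def
      proof (rule convex_combination_le)
        fix z assume z: "z \<in> Y" "\<rho> z y \<noteq> 0"
        have "(dist (q x) z)\<^sup>2 \<le> (dist x y)\<^sup>2 + \<eta>"
          using near[OF x y, of "q x" z] q(2)[OF x] \<rho>(4)[OF y z] by simp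
        then have "l * b\<^sup>2 * (dist (q x) z)\<^sup>2 \<le> l * b\<^sup>2 * ((dist x y)\<^sup>2 + \<eta>)"
          using pos by (intro mult_left_mono) auto
        then show "f z \<le> l * b\<^sup>2 * (dist x y)\<^sup>2 + \<delta> - \<phi> (q x)"
          using \<phi>f[of "q x" z] q(2)[OF x] z by (simp add: \<delta>_def distrib_left)
      qed (use \<rho> y in auto)
      then show "\<phi> (q x) - \<delta> \<le> l * b\<^sup>2 * (dist x y)\<^sup>2 - g y" by linarith
    qed
    moreover have "\<phi> (q x) - \<delta> \<le> l * a" using \<phi>[of "q x"] q(2)[OF x] \<delta> by auto
    ultimately show ?thesis by (simp add: Sbar_op_def)
  qed
  define C where "C y = {x \<in> K. q x = y}" for y
  have Cb: "C y \<in> sets borel" for y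
  proof -
    have "C y = K \<inter> q -` {y}" by (auto simp: C_def)
    then show ?thesis using Kb measurable_sets_borel[OF q(1), of "{y}"] by auto
  qed
  \<comment> \<open>On \<open>K\<close> this is \<open>\<phi> (q x) - \<delta>\<close>; written over
    the cells, it has a finite sum as its integral.\<close>
  define s where "s x = (\<Sum>y\<in>Y. indicator (C y) x * \<phi> y) - \<delta>" for x
  have CM: "C y \<in> sets M" for y using Cb fM by simp
  have int: "integrable M (\<lambda>x. indicator (C y) x * \<phi> y)" for y
    using CM by (intro integrable_mult_left) (simp add: integrable_indicator_iff M.emeasure_eq_measure)
  have "integral\<^sup>L M s = (\<Sum>y\<in>Y. measure M (C y) * \<phi> y) - \<delta> * measure M UNIV"
    unfolding s_def using int CM fM by (simp add: mult.commute)
  moreover have "integral\<^sup>L M s \<le> (LINT x:K|M. Sbar_op a b K l g x)"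
  \<comment> \<open>For empty \<open>K\<close> the infimum in \<open>S_op\<close> ranges over
    nothing; then \<open>M\<close> is zero, \<open>Y\<close> is empty and both sides vanish.\<close>
  proof (cases "K = {}")
    case True
    then have "measure M UNIV = 0" "Y = {}" using M(2) Y by (auto simp: measure_def)
    then show ?thesis using True \<open>integral\<^sup>L M s = _\<close> by (simp add: set_lebesgue_integral_def)
  next
    case False
    have S: "Sbar_op a b K l g \<in> borel_measurable borel" "\<And>x. \<bar>Sbar_op a b K l g x\<bar> \<le> l * a"
      using Sbar_op_props[where l = l and a = a and K = K and f = g and b = b, OF _ _ g_le False] pos by auto
    have "AE x in M. x \<in> K" using M(2) Kb fM by (intro AE_I[of _ _ "- K"]) auto
    moreover have "s x \<le> Sbar_op a b K l g x" if "x \<in> K" for x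
    proof -
      have "(\<Sum>y\<in>Y. indicator (C y) x * \<phi> y) = (\<Sum>y\<in>Y. if y = q x then \<phi> y else 0)"
        using that by (intro sum.cong) (auto simp: C_def)
      then show ?thesis using pw[OF that] Y q(2)[OF that] by (simp add: s_def)
    qed
    ultimately have "integral\<^sup>L M s \<le> integral\<^sup>L M (Sbar_op a b K l g)"
      using int finite_borel_measures_integrable[OF M(1) S] unfolding s_def
      by (intro integral_mono_AE) auto
    then show ?thesis using set_integral_eq_of_null_compl[OF M(1) Kb M(2) S(1) refl] by simp
  qed
  ultimately show "(\<Sum>y\<in>Y. measure M {x \<in> K. q x = y} * \<phi> y) - l * b\<^sup>2 * \<eta> * measure M UNIV
         \<le> (LINT x:K|M. Sbar_op a b K l g x)"
    by (simp add: C_def \<delta>_def)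
qed

section \<open>Cell masses, zero-sum potentials and the equality of the two values\<close>

lemma sum_cell_measures:
  fixes M :: "'a::polish_space measure" and q :: "'a \<Rightarrow> 'a"
  assumes M: "M \<in> finite_borel_measures" "emeasure M (- K) = 0" and K: "closed K"
    and Y: "finite Y" and q: "q \<in> borel_measurable borel" "\<And>x. x \<in> K \<Longrightarrow> q x \<in> Y"
  shows "(\<Sum>y\<in>Y. measure M {x \<in> K. q x = y}) = measure M UNIV"
proof -
  note fM = finite_borel_measuresD[OF M(1)]
  interpret M: finite_measure M by (rule fM)
  define C where "C y = {x \<in> K. q x = y}" for y
  have Kb: "K \<in> sets borel" using K by (rule borel_closed)
  have Cb: "C y \<in> sets borel" for y
  proof -
    have "C y = K \<inter> q -` {y}" by (auto simp: C_def)
    then show ?thesis using Kb measurable_sets_borel[OF q(1), of "{y}"] by auto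
  qed
  have "(\<Sum>y\<in>Y. measure M (C y)) = measure M (\<Union>y\<in>Y. C y)"
    using Y Cb fM by (intro M.finite_measure_finite_Union[symmetric])
      (auto simp: disjoint_family_on_def C_def)
  also have "(\<Union>y\<in>Y. C y) = K" using q(2) by (auto simp: C_def)
  also have "measure M K = measure M UNIV"
    using M.finite_measure_compl[of K] M(2) Kb fM by (simp add: measure_def Compl_eq_Diff_UNIV)
  finally show ?thesis by (simp add: C_def)
qed

text \<open>Weak duality adds to each summand the integral of \<open>f i\<close> against the common
  measure \<open>N\<close>; the total added is zero. Boundedness on \<open>K\<close> lets the finite
  sum pass through the integral.\<close>

lemma sum_set_integral_eq_0:
  fixes f :: "nat \<Rightarrow> 'a::polish_space \<Rightarrow> real"
  assumes N: "N \<in> finite_borel_measures" "emeasure N (- K) = 0" and K: "closed K"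
    and f: "\<And>i. i \<in> I \<Longrightarrow> f i \<in> F_set a K (l i)" and 0: "\<And>x. x \<in> K \<Longrightarrow> (\<Sum>i\<in>I. f i x) = 0"
  shows "(\<Sum>i\<in>I. (LINT x:K|N. f i x)) = 0"
proof -
  define g where "g i x = (if x \<in> K then f i x else 0)" for i x
  have Kb: "K \<in> sets borel" using K by (rule borel_closed)
  have g: "g i \<in> borel_measurable borel" "integrable N (g i)" if "i \<in> I" for i
  proof -
    note fi = f[OF that]
    show gm: "g i \<in> borel_measurable borel"
      unfolding g_def using Kb fi
      by (intro borel_measurable_continuous_on_if) (auto simp: F_set_def)
    obtain B where "0 < B" "\<And>x. x \<in> K \<Longrightarrow> \<bar>f i x\<bar> \<le> B"
      using fi by (auto simp: F_set_def bounded_pos)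
    then show "integrable N (g i)"
      by (intro finite_borel_measures_integrable[OF N(1) gm, of B]) (simp add: g_def)
  qed
  have "(\<Sum>i\<in>I. (LINT x:K|N. f i x)) = (\<Sum>i\<in>I. integral\<^sup>L N (g i))"
    by (intro sum.cong refl set_integral_eq_of_null_compl[OF N(1) Kb N(2)] g(1)) (simp_all add: g_def)
  also have "\<dots> = integral\<^sup>L N (\<lambda>x. \<Sum>i\<in>I. g i x)"
    using g(2) by (intro Bochner_Integration.integral_sum[symmetric])
  also have "(\<lambda>x. \<Sum>i\<in>I. g i x) = (\<lambda>x. 0)"
  proof
    show "(\<Sum>i\<in>I. g i x) = 0" for x using 0 by (cases "x \<in> K") (simp_all add: g_def)
  qed
  finally show ?thesis by simp
qed

theorem theorem4p9:
  fixes a b :: real and k :: nat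
    and \<mu> :: "nat \<Rightarrow> 'a::polish_space measure" and lam :: "nat \<Rightarrow> real" and K :: "'a set"
  assumes "a > 0" and "b > 0"
    and "locally compact (UNIV :: 'a set)"
    and "k \<ge> 2"
    and "\<And>i. i \<in> {1..k} \<Longrightarrow> \<mu> i \<in> finite_borel_measures"
    and "\<And>i. i \<in> {1..k} \<Longrightarrow> compact (supp_measure (\<mu> i))"
    and "\<And>i. i \<in> {1..k} \<Longrightarrow> lam i > 0"
    and "(\<Sum>i=1..k. lam i) = 1"
    and "K = (\<Union>i\<in>{1..k}. supp_measure (\<mu> i))"
  shows "Inf {\<Sum>i=1..k. lam i * (gen_wasserstein a b (\<mu> i) \<nu>)\<^sup>2 | \<nu>.
                \<nu> \<in> finite_borel_measures \<and> supp_measure \<nu> \<subseteq> K}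
       = Sup {\<Sum>i=1..k. (LINT x:K|\<mu> i. Sbar_op a b K (lam i) (f i) x) | f.
                (\<forall>i\<in>{1..k}. f i \<in> F_set a K (lam i)) \<and> (\<forall>x\<in>K. (\<Sum>i=1..k. f i x) = 0)}"
    (is "Inf ?A = Sup ?B")
proof (rule antisym)
  note \<mu> = assms(5) and lam = assms(7)
  have K: "compact K" unfolding assms(9) using assms(6) by (intro compact_UN) auto
  then have clK: "closed K" by (rule compact_imp_closed)
  have null: "emeasure N (- K) = 0"
    if "N \<in> finite_borel_measures" "supp_measure N \<subseteq> K" for N :: "'a measure"
  proof -
    note fN = finite_borel_measuresD[OF that(1)]
    have "- supp_measure N \<in> sets N"
      using emeasure_compl_supp_measure(1)[OF fN(1)] fN(1) by auto
    then have "emeasure N (- K) \<le> emeasure N (- supp_measure N)"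
      using that(2) by (intro emeasure_mono) auto
    then show ?thesis using emeasure_compl_supp_measure(2)[OF fN(1)] by simp
  qed
  have \<mu>K: "emeasure (\<mu> i) (- K) = 0" if "i \<in> {1..k}" for i
    using that assms(9) by (intro null \<mu>) auto
  have A_nn: "0 \<le> s" if "s \<in> ?A" for s
  proof -
    have "0 \<le> (\<Sum>i=1..k. lam i * (gen_wasserstein a b (\<mu> i) \<nu>)\<^sup>2)" for \<nu>
      using lam by (intro sum_nonneg mult_nonneg_nonneg) (auto intro: less_imp_le)
    then show ?thesis using that by blast
  qed
  \<comment> \<open>Real \<open>Inf\<close> and \<open>Sup\<close> need nonempty bounded sets: the
    null measure and the zero potentials are admissible, and weak duality bounds \<open>?B\<close>
    from above.\<close>
  have bddA: "bdd_below ?A" using A_nn by (rule bdd_belowI)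
  have neA: "?A \<noteq> {}"
  proof -
    have "null_measure borel \<in> (finite_borel_measures :: 'a measure set)"
      by (auto simp: finite_borel_measures_def intro!: finite_measureI)
    moreover have "supp_measure (null_measure borel :: 'a measure) \<subseteq> K"
      by (auto simp: supp_measure_def)
    ultimately show ?thesis by blast
  qed
  have neB: "?B \<noteq> {}"
  proof -
    have "bounded ((\<lambda>_. 0 :: real) ` K)" by (rule bounded_subset[of "{0}"]) auto
    moreover have "0 \<le> lam i * a" if "i \<in> {1..k}" for i using lam[OF that] assms(1) by simp
    ultimately have "\<forall>i\<in>{1..k}. (\<lambda>_. 0) \<in> F_set a K (lam i)" by (simp add: F_set_def)
    then have "\<exists>f. (\<forall>i\<in>{1..k}. f i \<in> F_set a K (lam i)) \<and> (\<forall>x\<in>K. (\<Sum>i=1..k. f i x) = 0)"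
      by (intro exI[of _ "\<lambda>_ _. 0"]) simp
    then show ?thesis by blast
  qed
  have weak: "t \<le> s" if t: "t \<in> ?B" and s: "s \<in> ?A" for s t
  proof -
    obtain \<nu> where \<nu>: "\<nu> \<in> finite_borel_measures" "supp_measure \<nu> \<subseteq> K"
      and s: "s = (\<Sum>i=1..k. lam i * (gen_wasserstein a b (\<mu> i) \<nu>)\<^sup>2)" using s by blast
    obtain f where f: "\<And>i. i \<in> {1..k} \<Longrightarrow> f i \<in> F_set a K (lam i)"
        "\<And>x. x \<in> K \<Longrightarrow> (\<Sum>i=1..k. f i x) = 0"
      and t: "t = (\<Sum>i=1..k. (LINT x:K|\<mu> i. Sbar_op a b K (lam i) (f i) x))" using t by blast
    \<comment> \<open>The added integrals against \<open>\<nu>\<close> sum to zero. Each transformed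
      potential now stands next to its \<open>f i\<close>, so duality applies summand by
      summand.\<close>
    have "t = (\<Sum>i=1..k. (LINT x:K|\<mu> i. Sbar_op a b K (lam i) (f i) x) + (LINT x:K|\<nu>. f i x))"
      using sum_set_integral_eq_0[OF \<nu>(1) null[OF \<nu>] clK f] by (simp add: t sum.distrib)
    also have "\<dots> \<le> s" unfolding s
      using assms(1,2) lam \<mu> \<mu>K f \<nu> null[OF \<nu>] clK
      by (intro sum_mono Sbar_op_weak_duality) auto
    finally show ?thesis .
  qed
  then have bddB: "bdd_above ?B" using neA by (meson bdd_aboveI ex_in_conv)
  show "Sup ?B \<le> Inf ?A"
    using neA neB weak by (intro cSup_least cInf_greatest)
  show "Inf ?A \<le> Sup ?B"
  proof (rule field_le_epsilon)
    fix e :: real assume e: "0 < e"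
    define T where "T = (\<Sum>i=1..k. lam i * b\<^sup>2 * measure (\<mu> i) UNIV)"
    have T: "0 \<le> T" unfolding T_def
      using lam by (intro sum_nonneg mult_nonneg_nonneg) (auto intro: less_imp_le)
    \<comment> \<open>Replacing distances by those of the net costs at most
      \<open>\<eta> * T\<close> in either branch, half of the allowance \<open>e\<close>; the
      summand 1 covers \<open>T = 0\<close>.\<close>
    define \<eta> where "\<eta> = e / (2 * (T + 1))"
    have \<eta>: "0 < \<eta>" using e T by (simp add: \<eta>_def)
    have \<eta>T: "\<eta> * T \<le> e / 2"
    proof -
      have "\<eta> * T \<le> \<eta> * (T + 1)" using \<eta> by simp
      also have "\<dots> = e / 2" using T by (simp add: \<eta>_def field_simps)
      finally show ?thesis .
    qed
    obtain \<epsilon> where \<epsilon>: "0 < \<epsilon>" and near: "\<And>x y x' y'. x \<in> K \<Longrightarrow> y \<in> K \<Longrightarrow> dist x x' < \<epsilon>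
        \<Longrightarrow> dist y y' < \<epsilon> \<Longrightarrow> (dist x' y')\<^sup>2 \<le> (dist x y)\<^sup>2 + \<eta>"
      using compact_dist_square_near[OF K \<eta>] by blast
    obtain Y q where Y: "finite Y" "Y \<subseteq> K" and q: "q \<in> borel_measurable borel"
      and qY: "\<And>x. x \<in> K \<Longrightarrow> q x \<in> Y \<and> dist x (q x) < \<epsilon>"
      using compact_measurable_quantization[OF K \<epsilon>] by blast
    define m where "m i y = measure (\<mu> i) {x \<in> K. q x = y}" for i y
    define V where "V = Inf ?A - e / 2"
    have c: "0 \<le> lam i * b\<^sup>2 * (dist y z)\<^sup>2" if "i \<in> {1..k}" for i and y z :: 'a
      using lam[OF that] by simp
    have u: "0 \<le> lam i * a" if "i \<in> {1..k}" for i using lam[OF that] assms(1) by simp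
    have I: "{1..k} \<noteq> {}" using assms(4) by simp
    show "Inf ?A \<le> Sup ?B + e"
    proof (rule discrete_barycenter_alternative[where I = "{1..k}" and Y = Y and m = m and V = V
          and c = "\<lambda>i y z. lam i * b\<^sup>2 * (dist y z)\<^sup>2" and u = "\<lambda>i. lam i * a", OF _ Y(1) I c u])
      fix \<phi> f
      assume \<phi>f: "\<And>i y z. i \<in> {1..k} \<Longrightarrow> y \<in> Y \<Longrightarrow> z \<in> Y \<Longrightarrow> \<phi> i y + f i z \<le> lam i * b\<^sup>2 * (dist y z)\<^sup>2"
        and \<phi>: "\<And>i y. i \<in> {1..k} \<Longrightarrow> y \<in> Y \<Longrightarrow> \<phi> i y \<le> lam i * a"
        and f: "\<And>i y. i \<in> {1..k} \<Longrightarrow> y \<in> Y \<Longrightarrow> f i y \<le> lam i * a"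
        and f0: "\<And>y. y \<in> Y \<Longrightarrow> (\<Sum>i=1..k. f i y) = 0"
        and V: "V \<le> (\<Sum>i=1..k. \<Sum>y\<in>Y. m i y * \<phi> i y)"
      have "\<exists>z\<in>Y. dist x z < \<epsilon>" if "x \<in> K" for x using qY[OF that] by blast
      from net_partition_of_unity[OF Y(1) this]
      obtain \<rho> :: "'a \<Rightarrow> 'a \<Rightarrow> real" where \<rho>: "\<And>z. continuous_on K (\<rho> z)"
        "\<And>x z. x \<in> K \<Longrightarrow> z \<in> Y \<Longrightarrow> 0 \<le> \<rho> z x"
        "\<And>x. x \<in> K \<Longrightarrow> (\<Sum>z\<in>Y. \<rho> z x) = 1"
        "\<And>x z. x \<in> K \<Longrightarrow> z \<in> Y \<Longrightarrow> \<rho> z x \<noteq> 0 \<Longrightarrow> dist x z < \<epsilon>" by blast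
      define g where "g i x = (\<Sum>z\<in>Y. \<rho> z x * f i z)" for i x
      note ip = Sbar_op_interpolation[OF assms(1,2) lam K \<mu> \<mu>K Y q qY near \<eta> \<rho> \<phi>f \<phi> f]
      have gF: "g i \<in> F_set a K (lam i)" if "i \<in> {1..k}" for i
        unfolding g_def[abs_def] using that by (intro ip(1)[of i]) auto
      have gS: "(\<Sum>y\<in>Y. m i y * \<phi> i y) - lam i * b\<^sup>2 * \<eta> * measure (\<mu> i) UNIV
          \<le> (LINT x:K|\<mu> i. Sbar_op a b K (lam i) (g i) x)" if "i \<in> {1..k}" for i
        unfolding g_def[abs_def] m_def using that by (intro ip(2)[of i]) auto
      have g0: "(\<Sum>i=1..k. g i x) = 0" for x
      proof -
        have "(\<Sum>i=1..k. g i x) = (\<Sum>z\<in>Y. \<rho> z x * (\<Sum>i=1..k. f i z))"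
          unfolding g_def by (subst sum.swap) (simp add: sum_distrib_left)
        then show ?thesis using f0 by simp
      qed
      have "V - \<eta> * T \<le> (\<Sum>i=1..k. (\<Sum>y\<in>Y. m i y * \<phi> i y) - lam i * b\<^sup>2 * \<eta> * measure (\<mu> i) UNIV)"
        using V by (simp add: sum_subtractf T_def sum_distrib_left mult_ac)
      also have "\<dots> \<le> (\<Sum>i=1..k. (LINT x:K|\<mu> i. Sbar_op a b K (lam i) (g i) x))"
        by (rule sum_mono) (rule gS)
      also have "\<dots> \<le> Sup ?B"
        using gF g0 by (intro cSup_upper[OF _ bddB]) blast
      finally show "Inf ?A \<le> Sup ?B + e" using \<eta>T by (simp add: V_def)
    next
      fix \<gamma> n
      assume \<gamma>: "\<And>i y z. i \<in> {1..k} \<Longrightarrow> y \<in> Y \<Longrightarrow> z \<in> Y \<Longrightarrow> 0 \<le> \<gamma> i y z"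
        and \<gamma>m: "\<And>i y. i \<in> {1..k} \<Longrightarrow> y \<in> Y \<Longrightarrow> (\<Sum>z\<in>Y. \<gamma> i y z) \<le> m i y"
        and \<gamma>n: "\<And>i z. i \<in> {1..k} \<Longrightarrow> z \<in> Y \<Longrightarrow> (\<Sum>y\<in>Y. \<gamma> i y z) \<le> n z"
        and V: "(\<Sum>i=1..k. (\<Sum>y\<in>Y. \<Sum>z\<in>Y. lam i * b\<^sup>2 * (dist y z)\<^sup>2 * \<gamma> i y z)
            + lam i * a * (\<Sum>y\<in>Y. m i y - (\<Sum>z\<in>Y. \<gamma> i y z))
            + lam i * a * (\<Sum>z\<in>Y. n z - (\<Sum>y\<in>Y. \<gamma> i y z))) < V"
      \<comment> \<open>The discrete alternative does not state this sign; the plan of any single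
        index implies it, and 1 is an index.\<close>
      have n: "0 \<le> n z" if "z \<in> Y" for z
      proof -
        have "1 \<in> {1..k}" using assms(4) by simp
        then have "0 \<le> (\<Sum>y\<in>Y. \<gamma> 1 y z)" using \<gamma> that by (intro sum_nonneg) blast
        then show ?thesis using \<gamma>n[OF \<open>1 \<in> {1..k}\<close> that] by linarith
      qed
      obtain N :: "'a measure" where N: "N \<in> finite_borel_measures"
        "\<And>A. A \<in> sets borel \<Longrightarrow> emeasure N A = ennreal (\<Sum>z\<in>Y. n z * indicator A z)"
        using discrete_finite_borel_measure[of Y n, OF Y(1) n] by blast
      have "(\<Sum>z\<in>Y. n z * indicator (- K) z) = 0" using Y by (intro sum.neutral) auto
      then have "emeasure N (- K) = 0" using N(2)[of "- K"] clK by simp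
      then have supN: "supp_measure N \<subseteq> K" by (rule supp_measure_subset_closed[OF clK])
      define g where "g i = (\<Sum>y\<in>Y. \<Sum>z\<in>Y. \<gamma> i y z)" for i
      define D where "D i = (\<Sum>y\<in>Y. \<Sum>z\<in>Y. (dist y z)\<^sup>2 * \<gamma> i y z)" for i
      have mass: "(\<Sum>y\<in>Y. m i y) = measure (\<mu> i) UNIV" if "i \<in> {1..k}" for i
        unfolding m_def using qY by (intro sum_cell_measures[OF \<mu>[OF that] \<mu>K[OF that] clK Y(1) q]) auto
      have g_le: "g i \<le> measure (\<mu> i) UNIV" if "i \<in> {1..k}" for i
        unfolding g_def mass[OF that, symmetric] using \<gamma>m[OF that] by (rule sum_mono)
      have GW: "lam i * (gen_wasserstein a b (\<mu> i) N)\<^sup>2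
          \<le> (lam i * b\<^sup>2 * D i + lam i * a * ((\<Sum>y\<in>Y. m i y) - g i) + lam i * a * ((\<Sum>z\<in>Y. n z) - g i))
            + lam i * b\<^sup>2 * \<eta> * measure (\<mu> i) UNIV" if i: "i \<in> {1..k}" for i
      proof -
        \<comment> \<open>The cost may depend on \<open>x\<close> only through its cell, hence the
          squared distance from \<open>q x\<close> enlarged by \<open>\<eta>\<close>. The excess is
          charged to \<open>g i\<close>, which is at most the mass of
          \<open>\<mu> i\<close>.\<close>
        have "(gen_wasserstein a b (\<mu> i) N)\<^sup>2 \<le> a * (measure (\<mu> i) UNIV - g i) + a * ((\<Sum>z\<in>Y. n z) - g i)
            + b\<^sup>2 * (\<Sum>y\<in>Y. \<Sum>z\<in>Y. ((dist y z)\<^sup>2 + \<eta>) * \<gamma> i y z)"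
          unfolding g_def
        proof (rule gen_wasserstein_le_quantized[OF _ K \<mu>[OF i] N(1) Y q _ N(2)])
          show "(\<Sum>z\<in>Y. \<gamma> i y z) \<le> measure (\<mu> i) {x \<in> K. q x = y}" if "y \<in> Y" for y
            using \<gamma>m[OF i that] by (simp add: m_def)
          show "(dist x z)\<^sup>2 \<le> (dist (q x) z)\<^sup>2 + \<eta>" if "x \<in> K" "z \<in> Y" for x z
            using near[of "q x" z x z] qY[OF that(1)] that Y \<epsilon> by (auto simp: dist_commute)
        qed (use assms(1) qY \<gamma>[OF i] \<gamma>n[OF i] in auto)
        also have "(\<Sum>y\<in>Y. \<Sum>z\<in>Y. ((dist y z)\<^sup>2 + \<eta>) * \<gamma> i y z) = D i + \<eta> * g i"
          by (simp add: D_def g_def distrib_right sum.distrib sum_distrib_left)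
        also have "b\<^sup>2 * (D i + \<eta> * g i) \<le> b\<^sup>2 * (D i + \<eta> * measure (\<mu> i) UNIV)"
          using g_le[OF i] \<eta> by (intro mult_left_mono add_left_mono) auto
        finally have "lam i * (gen_wasserstein a b (\<mu> i) N)\<^sup>2
          \<le> lam i * (a * (measure (\<mu> i) UNIV - g i) + a * ((\<Sum>z\<in>Y. n z) - g i)
            + b\<^sup>2 * (D i + \<eta> * measure (\<mu> i) UNIV))"
          using lam[OF i] by (intro mult_left_mono) auto
        then show ?thesis by (simp add: mass[OF i] algebra_simps)
      qed
      have LP: "(\<Sum>i=1..k. lam i * b\<^sup>2 * D i + lam i * a * ((\<Sum>y\<in>Y. m i y) - g i)
          + lam i * a * ((\<Sum>z\<in>Y. n z) - g i)) < V"
      proof -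
        have "(\<Sum>z\<in>Y. \<Sum>y\<in>Y. \<gamma> i y z) = g i" for i unfolding g_def by (rule sum.swap)
        then show ?thesis
          using V by (simp add: D_def sum_subtractf sum_distrib_left mult.assoc flip: g_def)
      qed
      have "Inf ?A \<le> (\<Sum>i=1..k. lam i * (gen_wasserstein a b (\<mu> i) N)\<^sup>2)"
        using N(1) supN by (intro cInf_lower[OF _ bddA]) blast
      also have "\<dots> \<le> (\<Sum>i=1..k. (lam i * b\<^sup>2 * D i + lam i * a * ((\<Sum>y\<in>Y. m i y) - g i)
          + lam i * a * ((\<Sum>z\<in>Y. n z) - g i)) + lam i * b\<^sup>2 * \<eta> * measure (\<mu> i) UNIV)"
        by (rule sum_mono) (rule GW)
      also have "\<dots> < V + \<eta> * T"
        using LP by (simp add: sum.distrib T_def sum_distrib_left mult_ac)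
      \<comment> \<open>As \<open>\<eta> * T \<le> e / 2\<close>, the value at \<open>N\<close>
        would lie strictly below \<open>Inf ?A\<close>.\<close>
      finally have False using \<eta>T by (simp add: V_def)
      then show "Inf ?A \<le> Sup ?B + e" ..
    qed simp_all
  qed
qed

end
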